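(* Let $k \ge 4$ and $G$ be a $k$-dicritical digraph. If $G$ is neither $\overset \leftrightarrow K_k$ nor in $\mathcal D_k$, then:\[\lvert A(G)\rvert \ge (k-1)\lvert V(G)\rvert + (k-2).\]
   Context: A dicolouring of a digraph is a partition of its vertex set into sets inducing acyclic subdigraphs; $\vec{\chi}(G)$ is the minimum number of parts. $G$ is $k$-dicritical if $\vec{\chi}(G)=k$ and every proper subdigraph has dichromatic number at most $k-1$. $\overset \leftrightarrow K_m$ is the complete symmetric digraph on $m$ vertices and $\overset \leftrightarrow C_5$ the symmetric cycle on 5 vertices (each edge of the 5-cycle replaced by a digon). For a digraph $H$ with vertices $u_1,\dots,u_n$ and digraphs $G_1,\dots,G_n$, the substitution $H(G_1,\dots,G_n)$ is obtained by replacing each $u_i$ by a copy of $G_i$ and, for each arc $u_iu_j$ of $H$, adding all arcs from $V(G_i)$ to $V(G_j)$. For $k\ge 4$, $\mathcal D_k = \{\overset \leftrightarrow C_5(\overset \leftrightarrow K_{k-2}, \overset \leftrightarrow K_1, \overset \leftrightarrow K_n, \overset \leftrightarrow K_{k-1-n}, \overset \leftrightarrow K_1) : 1 \le n \le k-2\}$ (substituting along the cyclic order of $\overset \leftrightarrow C_5$); these are symmetric $k$-dicritical digraphs with exactly $(k-1)\lvert V\rvert+k-3$ arcs. *)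

theory Defs
  imports "Graph_Theory.Graph_Theory" "HOL-Library.Disjoint_Sets"
begin

text \<open>
  Digraphs are those of the locale \<^locale>\<open>digraph\<close>: finite, without loops and without parallel
  arcs. A pair of opposite arcs (a digon) is allowed, and counts as a directed cycle.
\<close>

definition acyclic_digraph :: "('a, 'b) pre_digraph \<Rightarrow> bool" where
  "acyclic_digraph G \<longleftrightarrow> \<not> (\<exists>p. pre_digraph.cycle G p)"

definition dicolouring :: "('a, 'b) pre_digraph \<Rightarrow> 'a set set \<Rightarrow> bool" where
  "dicolouring G P \<longleftrightarrow> partition_on (verts G) P \<and> (\<forall>X\<in>P. acyclic_digraph (G \<restriction> X))"

definition dichromatic_number :: "('a, 'b) pre_digraph \<Rightarrow> nat" where
  "dichromatic_number G = (LEAST n. \<exists>P. dicolouring G P \<and> finite P \<and> card P = n)"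

lemma (in digraph) dicolouring_singletons:
  "dicolouring G ((\<lambda>v. {v}) ` verts G)"
proof -
  have "acyclic_digraph (G \<restriction> {v})" if "v \<in> verts G" for v
  proof -
    have "arcs (G \<restriction> {v}) = {}"
      by (auto dest: no_loops)
    then show ?thesis
      by (simp add: acyclic_digraph_def pre_digraph.cycle_def pre_digraph.awalk_def
            del: induce_subgraph_arcs)
  qed
  then show ?thesis
    by (auto simp: dicolouring_def partition_on_def disjoint_def)
qed

text \<open>So the \<^const>\<open>Least\<close> above ranges over a nonempty set for every digraph.\<close>

lemma (in digraph) dichromatic_number_attained:
  "\<exists>P. dicolouring G P \<and> finite P \<and> card P = dichromatic_number G"
  unfolding dichromatic_number_def
  by (rule LeastI_ex)
    (use dicolouring_singletons finite_verts in \<open>blast intro: finite_imageI\<close>)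

definition dicritical :: "nat \<Rightarrow> ('a, 'b) pre_digraph \<Rightarrow> bool" where
  "dicritical k G \<longleftrightarrow> dichromatic_number G = k \<and>
     (\<forall>H. subgraph H G \<and> H \<noteq> G \<longrightarrow> dichromatic_number H \<le> k - 1)"

definition bidirected_complete :: "nat \<Rightarrow> nat pair_pre_digraph" where
  "bidirected_complete m =
     \<lparr> pverts = {..<m}, parcs = {(u, v). u < m \<and> v < m \<and> u \<noteq> v} \<rparr>"

text \<open>Intended for \<open>m \<ge> 3\<close>.\<close>

definition bidirected_cycle :: "nat \<Rightarrow> nat pair_pre_digraph" where
  "bidirected_cycle m =
     \<lparr> pverts = {..<m},
       parcs = {(u, v). u < m \<and> v < m \<and> (v = (u + 1) mod m \<or> u = (v + 1) mod m)} \<rparr>"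

text \<open>\<open>substitution H F\<close> is \<open>H(F u\<^sub>1, \<dots>, F u\<^sub>n)\<close>; the copy of \<open>F u\<close> lives on
  \<open>{u} \<times> V(F u)\<close>.\<close>

definition substitution ::
  "'a pair_pre_digraph \<Rightarrow> ('a \<Rightarrow> 'b pair_pre_digraph) \<Rightarrow> ('a \<times> 'b) pair_pre_digraph" where
  "substitution H F =
     \<lparr> pverts = (SIGMA u : pverts H. pverts (F u)),
       parcs = {((u, x), (u, y)) | u x y. u \<in> pverts H \<and> (x, y) \<in> parcs (F u)} \<union>
               {((u, x), (v, y)) | u v x y.
                  (u, v) \<in> parcs H \<and> x \<in> pverts (F u) \<and> y \<in> pverts (F v)} \<rparr>"

definition \<D> :: "nat \<Rightarrow> (nat \<times> nat) pair_pre_digraph set" where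
  "\<D> k = {substitution (bidirected_cycle 5)
            (\<lambda>i. [bidirected_complete (k - 2), bidirected_complete 1, bidirected_complete n,
                  bidirected_complete (k - 1 - n), bidirected_complete 1] ! i)
          | n. 1 \<le> n \<and> n \<le> k - 2}"

text \<open>The library predicate \<^const>\<open>complete_digraph\<close> describes exactly the digraphs isomorphic to
  \<^const>\<open>bidirected_complete\<close>.\<close>

lemma complete_digraph_bidirected_complete:
  "complete_digraph m (with_proj (bidirected_complete m))"
  by (auto simp: complete_digraph_pair_def bidirected_complete_def)

lemma (in digraph) complete_digraph_iff_iso:
  "complete_digraph m G \<longleftrightarrow> digraph_iso G (with_proj (bidirected_complete m))"
proof
  assume K: "complete_digraph m G"
  have "card (verts G) = m"
    using K by (simp add: complete_digraph_def)
  then obtain f where f: "bij_betw f (verts G) {..<m}"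
    using finite_verts finite_same_card_bij[of "verts G" "{..<m}"] by auto
  define h where "h = \<lparr> iso_verts = f, iso_arcs = (\<lambda>e. (f (tail G e), f (head G e))),
    iso_head = snd, iso_tail = fst \<rparr>"
  have inj: "inj_on f (verts G)"
    using f by (simp add: bij_betw_def)
  have "inj_on (iso_arcs h) (arcs G)"
    by (rule inj_onI)
      (auto simp: h_def arc_to_ends_def inj_on_eq_iff[OF inj] intro!: no_multi_arcs)
  then have "digraph_isomorphism h"
    using inj wf_digraph by (auto simp: digraph_isomorphism_def h_def)
  moreover have "iso_arcs h ` arcs G = (\<lambda>(u, v). (f u, f v)) ` arcs_ends G"
    by (auto simp: h_def arcs_ends_conv image_image)
  then have "iso_arcs h ` arcs G = {(u, v). u < m \<and> v < m \<and> u \<noteq> v}"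
  proof -
    have "(\<lambda>(u, v). (f u, f v)) ` {(u, v). (u, v) \<in> verts G \<times> verts G \<and> u \<noteq> v}
        = {(u, v). u \<in> f ` verts G \<and> v \<in> f ` verts G \<and> u \<noteq> v}"
      by (auto simp: image_iff dest: inj_onD[OF inj])
    with \<open>iso_arcs h ` arcs G = _\<close> show ?thesis
      using K f by (simp add: complete_digraph_def bij_betw_def)
  qed
  then have "with_proj (bidirected_complete m) = app_iso h G"
    using f by (simp add: app_iso_def with_proj_def bidirected_complete_def h_def bij_betw_def)
  ultimately show "digraph_iso G (with_proj (bidirected_complete m))"
    unfolding digraph_iso_def by blast
next
  assume "digraph_iso G (with_proj (bidirected_complete m))"
  then obtain h where h: "digraph_isomorphism h" "with_proj (bidirected_complete m) = app_iso h G"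
    unfolding digraph_iso_def by blast
  let ?f = "iso_verts h"
  have inj: "inj_on ?f (verts G)"
    using h(1) by (simp add: digraph_isomorphism_def)
  have V: "?f ` verts G = {..<m}"
    using arg_cong[OF h(2), of verts] by (simp add: bidirected_complete_def)
  have "arcs_ends (app_iso h G) = (\<lambda>(u, v). (?f u, ?f v)) ` arcs_ends G"
    using h(1) by (auto simp: arcs_ends_conv image_image digraph_isomorphism_def intro!: image_cong)
  then have A: "(\<lambda>(u, v). (?f u, ?f v)) ` arcs_ends G = {(u, v). u < m \<and> v < m \<and> u \<noteq> v}"
    using h(2)[symmetric] by (simp add: bidirected_complete_def)
  have "(u, v) \<in> arcs_ends G \<longleftrightarrow> u \<in> verts G \<and> v \<in> verts G \<and> u \<noteq> v" for u v
  proof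
    assume "(u, v) \<in> arcs_ends G"
    then show "u \<in> verts G \<and> v \<in> verts G \<and> u \<noteq> v"
      using adj_in_verts adj_not_same by blast
  next
    assume uv: "u \<in> verts G \<and> v \<in> verts G \<and> u \<noteq> v"
    then have "(?f u, ?f v) \<in> {(u, v). u < m \<and> v < m \<and> u \<noteq> v}"
      using V inj by (auto dest: inj_onD)
    then obtain u' v' where "(u', v') \<in> arcs_ends G" "?f u' = ?f u" "?f v' = ?f v"
      unfolding A[symmetric] by auto
    with uv show "(u, v) \<in> arcs_ends G"
      using adj_in_verts inj by (metis inj_onD)
  qed
  then have E: "arcs_ends G = {(u, v). (u, v) \<in> verts G \<times> verts G \<and> u \<noteq> v}"
    by auto
  moreover have "card (verts G) = m"
    using V inj by (metis card_image card_lessThan)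
  moreover have "graph G"
    by (rule graphI) (auto simp: symmetric_def E sym_def)
  ultimately show "complete_digraph m G"
    by (simp add: complete_digraph_def)
qed

end

theory Submission
  imports Defs
begin

text \<open>
  Put \<open>m = k - 1\<close> and let \<open>G\<close> have \<open>n\<close> vertices and at most \<open>m n + m - 2\<close> arcs, that is, the
  out-degrees exceed \<open>m\<close> by at most \<open>m - 2\<close> in total, and so do the in-degrees. Since at least \<open>m\<close>
  arcs leave every proper nonempty vertex set, every proper \<open>X\<close> spans at most \<open>m |X| - 2\<close> arcs; this
  makes \<open>G\<close> rigid.

  If \<open>v\<close> has out-degree \<open>m\<close>, its out-neighbours receive distinct colours in every \<open>m\<close>-dicolouring of
  \<open>G - v\<close>. So identifying two of them not joined by a digon gives a smaller critical digraph,
  which by induction and the sparsity bound is \<open>K\<^sub>k\<close> or in \<open>\<D>\<^sub>k\<close>; in particular \<open>G\<close> contains a clique \<open>Q\<close>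
  on \<open>m\<close> vertices. Hall's theorem shows that a dicolouring of \<open>G - Q\<close> can only fail to extend to
  \<open>G\<close> because one colour is forbidden on all of \<open>Q\<close>. Hence the neighbours outside \<open>Q\<close> of the
  vertices of \<open>Q\<close> of degree \<open>m\<close> (the ends of \<open>Q\<close>) always share a colour. If \<open>Q\<close> has two different
  ends, adding a digon between them creates a \<open>K\<^sub>k\<close>, and \<open>G\<close> turns out to be in \<open>\<D>\<^sub>k\<close>. If every
  clique has a single end, identifying the end \<open>w\<close> of \<open>Q\<close> with a vertex \<open>u\<close> of \<open>Q\<close> to which it is
  not joined by a digon yields a second clique disjoint from \<open>Q\<close> whose end is \<open>u\<close> or \<open>w\<close>, and that
  vertex has too large a degree.
\<close>

section \<open>Hall's marriage theorem\<close>

text \<open>Rado's argument: shrink a set that has two elements \<open>x\<close> and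
  \<open>y\<close>. If deleting \<open>x\<close> and deleting \<open>y\<close> both destroyed the
  condition, the witnesses \<open>J\<close> and \<open>K\<close> would contradict the submodularity
  of cardinalities. Once all sets are singletons, the condition for pairs gives injectivity.\<close>

lemma hall_marriage:
  fixes L :: "'a \<Rightarrow> 'b set"
  assumes "finite I" and "\<And>i. i \<in> I \<Longrightarrow> finite (L i)"
    and "\<And>J. J \<subseteq> I \<Longrightarrow> card J \<le> card (\<Union>(L ` J))"
  shows "\<exists>f. inj_on f I \<and> (\<forall>i\<in>I. f i \<in> L i)"
  using assms(2,3)
proof (induction "\<Sum>i\<in>I. card (L i)" arbitrary: L rule: less_induct)
  case less
  note fin = less.prems(1) and hall = less.prems(2)
  show ?case
  proof (cases "\<exists>i\<in>I. \<exists>x\<in>L i. \<exists>y\<in>L i. x \<noteq> y")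
    case True
    then obtain i x y where i: "i \<in> I" "x \<in> L i" "y \<in> L i" "x \<noteq> y" by blast
    define M where "M z = L(i := L i - {z})" for z
    have bad: "\<exists>J. J \<subseteq> I - {i} \<and> card (\<Union>(L ` J) \<union> (L i - {z})) \<le> card J"
      if z: "z \<in> L i" and no: "\<nexists>f. inj_on f I \<and> (\<forall>j\<in>I. f j \<in> M z j)" for z
    proof -
      have M_fin: "finite (M z j)" if "j \<in> I" for j
        using fin that by (auto simp: M_def)
      have "(\<Sum>j\<in>I. card (M z j)) < (\<Sum>j\<in>I. card (L j))"
      proof (rule sum_strict_mono_ex1)
        show "\<forall>j\<in>I. card (M z j) \<le> card (L j)"
          using fin by (auto simp: M_def card_mono)
        show "\<exists>j\<in>I. card (M z j) < card (L j)"
          using i(1) card_Diff1_less[OF fin[OF i(1)] z] by (intro bexI[of _ i]) (simp add: M_def)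
      qed (rule \<open>finite I\<close>)
      then have "\<not> (\<forall>J\<subseteq>I. card J \<le> card (\<Union>(M z ` J)))"
        using less.hyps[of "M z"] M_fin no by blast
      then obtain J where J: "J \<subseteq> I" "card (\<Union>(M z ` J)) < card J"
        by (auto simp: not_le)
      have "i \<in> J"
      proof (rule ccontr)
        assume "i \<notin> J"
        then have "\<Union>(M z ` J) = \<Union>(L ` J)" by (auto simp: M_def)
        with J(2) hall[OF J(1)] show False by simp
      qed
      moreover have "\<Union>(M z ` J) = \<Union>(L ` (J - {i})) \<union> (L i - {z})"
        using \<open>i \<in> J\<close> by (auto simp: M_def split: if_splits)
      moreover have "card J = Suc (card (J - {i}))"
        using \<open>i \<in> J\<close> J(1) \<open>finite I\<close> by (meson card.remove finite_subset)
      ultimately show ?thesis using J by (intro exI[of _ "J - {i}"]) auto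
    qed
    have sub: "f j \<in> L j" if "f j \<in> M z j" for f j z
      using that by (auto simp: M_def split: if_splits)
    show ?thesis
    proof (rule ccontr)
      assume "\<not> ?thesis"
      then have no: "\<nexists>f. inj_on f I \<and> (\<forall>j\<in>I. f j \<in> M z j)" for z
        using sub by blast
      obtain J K where J: "J \<subseteq> I - {i}" "card (\<Union>(L ` J) \<union> (L i - {x})) \<le> card J"
        and K: "K \<subseteq> I - {i}" "card (\<Union>(L ` K) \<union> (L i - {y})) \<le> card K"
        using bad[OF i(2) no] bad[OF i(3) no] by blast
      let ?A = "\<Union>(L ` J) \<union> (L i - {x})" and ?B = "\<Union>(L ` K) \<union> (L i - {y})"
      have finJK: "finite J" "finite K"
        using J(1) K(1) \<open>finite I\<close> by (meson finite_Diff finite_subset)+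
      have finAB: "finite ?A" "finite ?B"
        using finJK J(1) K(1) fin i(1) by auto
      have "card (insert i (J \<union> K)) \<le> card (\<Union>(L ` insert i (J \<union> K)))"
        using J(1) K(1) i(1) by (intro hall) auto
      also have "\<Union>(L ` insert i (J \<union> K)) \<subseteq> ?A \<union> ?B" using i by auto
      then have "card (\<Union>(L ` insert i (J \<union> K))) \<le> card (?A \<union> ?B)"
        using finAB by (meson card_mono finite_UnI)
      finally have "Suc (card (J \<union> K)) \<le> card (?A \<union> ?B)"
        using finJK J(1) K(1) by (subst (asm) card_insert_disjoint) auto
      moreover have "card (J \<inter> K) \<le> card (?A \<inter> ?B)"
      proof -
        have "card (J \<inter> K) \<le> card (\<Union>(L ` (J \<inter> K)))" using hall J(1) by blast
        also have "\<dots> \<le> card (?A \<inter> ?B)" using finAB by (intro card_mono) auto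
        finally show ?thesis .
      qed
      ultimately show False
        using card_Un_Int[OF finAB] card_Un_Int[OF finJK] J(2) K(2) by linarith
    qed
  next
    case False
    have ne: "L i \<noteq> {}" if "i \<in> I" for i
      using hall[of "{i}"] that by auto
    define f where "f i = (SOME x. x \<in> L i)" for i
    have f: "f i \<in> L i" if "i \<in> I" for i
      using ne[OF that] unfolding f_def by (simp add: some_in_eq)
    have "inj_on f I"
    proof (rule inj_onI)
      fix i j assume ij: "i \<in> I" "j \<in> I" "f i = f j"
      have "L i = {f i}" "L j = {f j}" using False f[OF ij(1)] f[OF ij(2)] ij(1,2) by blast+
      then have "card {i, j} \<le> 1" using hall[of "{i, j}"] ij by auto
      then show "i = j" by (auto simp: card_insert_if split: if_splits)
    qed
    then show ?thesis using f by blast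
  qed
qed

section \<open>Colourings of finite relations\<close>

text \<open>
  A loopless digraph without isolated vertices is identified with its set of arcs \<open>A\<close>, its vertex
  set being \<^term>\<open>Field A\<close>.
\<close>

definition monochr :: "('a \<Rightarrow> nat) \<Rightarrow> 'a rel \<Rightarrow> 'a rel" where
  "monochr \<phi> A = {(u, v) \<in> A. \<phi> u = \<phi> v}"

text \<open>Colours are bounded on the whole type, which avoids side conditions about vertices; as a
  result \<open>colourable 0 A\<close> fails even for empty \<open>A\<close>.\<close>

definition colourable :: "nat \<Rightarrow> 'a rel \<Rightarrow> bool" where
  "colourable m A \<longleftrightarrow> (\<exists>\<phi>. (\<forall>v. \<phi> v < m) \<and> acyclic (monochr \<phi> A))"

definition critical :: "nat \<Rightarrow> 'a rel \<Rightarrow> bool" where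
  "critical m A \<longleftrightarrow> \<not> colourable m A \<and> (\<forall>B. B \<subset> A \<longrightarrow> colourable m B)"

definition complete_on :: "'a set \<Rightarrow> 'a rel" where
  "complete_on X = {(u, v) \<in> X \<times> X. u \<noteq> v}"

lemma monochr_converse: "monochr \<phi> (A\<inverse>) = (monochr \<phi> A)\<inverse>"
  by (auto simp: monochr_def)

lemma colourable_converse [simp]: "colourable m (A\<inverse>) \<longleftrightarrow> colourable m A"
  by (simp add: colourable_def monochr_converse)

lemma critical_converse [simp]: "critical m (A\<inverse>) \<longleftrightarrow> critical m A"
proof -
  have "B \<subset> A\<inverse> \<longleftrightarrow> B\<inverse> \<subset> A" for B :: "'a rel"
    by (metis converse_converse converse_mono psubset_eq)
  then show ?thesis
    unfolding critical_def colourable_converse by (metis colourable_converse converse_converse)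
qed

lemma monochr_mono: "B \<subseteq> A \<Longrightarrow> monochr \<phi> B \<subseteq> monochr \<phi> A"
  by (auto simp: monochr_def)

lemma monochr_subset: "monochr \<phi> A \<subseteq> A"
  by (auto simp: monochr_def)

lemma colourable_mono: "colourable m A \<Longrightarrow> B \<subseteq> A \<Longrightarrow> colourable m B"
  unfolding colourable_def
  by (metis (no_types, lifting) acyclic_subset monochr_mono)

lemma complete_on_converse [simp]: "(complete_on X)\<inverse> = complete_on X"
  by (auto simp: complete_on_def)

lemma ex_critical_subset:
  assumes "finite A" "\<not> colourable m A"
  shows "\<exists>F \<subseteq> A. critical m F"
proof -
  let ?S = "{F. F \<subseteq> A \<and> \<not> colourable m F}"
  have "finite ?S" "?S \<noteq> {}" using assms by auto
  from finite_has_minimal[OF this] obtain F where "F \<in> ?S" "\<forall>B\<in>?S. B \<subseteq> F \<longrightarrow> F = B" ..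
  then have "critical m F" "F \<subseteq> A" unfolding critical_def by auto
  then show ?thesis by auto
qed

lemma card_complete_on:
  assumes "finite X"
  shows "card (complete_on X) = card X * (card X - 1)"
proof -
  have "complete_on X = (SIGMA u:X. X - {u})" by (auto simp: complete_on_def)
  then show ?thesis using assms by simp
qed

lemma not_colourable_complete_on:
  assumes "finite X" "m < card X"
  shows "\<not> colourable m (complete_on X)"
proof
  assume "colourable m (complete_on X)"
  then obtain \<phi> where \<phi>: "\<And>v. \<phi> v < m" "acyclic (monochr \<phi> (complete_on X))"
    unfolding colourable_def by blast
  have "\<not> inj_on \<phi> X"
  proof
    assume "inj_on \<phi> X"
    then have "card X \<le> card {..<m}"
      using \<phi>(1) by (intro card_inj_on_le[of \<phi>]) auto
    with assms show False by simp
  qed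
  then obtain u v where "u \<in> X" "v \<in> X" "u \<noteq> v" "\<phi> u = \<phi> v" by (auto simp: inj_on_def)
  then have "(u, v) \<in> monochr \<phi> (complete_on X)" "(v, u) \<in> monochr \<phi> (complete_on X)"
    by (auto simp: monochr_def complete_on_def)
  then show False using \<phi>(2) unfolding acyclic_def by (meson trancl.simps)
qed

lemma acyclic_no_digon: "acyclic R \<Longrightarrow> (u, v) \<in> R \<Longrightarrow> (v, u) \<notin> R"
  unfolding acyclic_def by (meson trancl.simps)

text \<open>No arc leaves \<open>X\<close>, so a directed cycle lies entirely inside
  \<open>X\<close> or entirely outside.\<close>

lemma acyclic_cut:
  assumes "finite R" "acyclic (Restr R X)" "acyclic (Restr R (- X))" "R \<inter> X \<times> (- X) = {}"
  shows "acyclic R"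
proof -
  let ?T = "R \<inter> (- X) \<times> X"
  have "wf ?T"
    by (rule wf_subset[of "measure (\<lambda>v. if v \<in> X then 1 else 0)"]) auto
  moreover have "wf (Restr R X)" "wf (Restr R (- X))"
    using assms by (auto intro: finite_acyclic_wf)
  ultimately have "wf (Restr R (- X) \<union> (?T \<union> Restr R X))"
    by (intro wf_Un) auto
  moreover have "R \<subseteq> Restr R (- X) \<union> (?T \<union> Restr R X)"
    using assms(4) by auto
  ultimately show ?thesis using wf_subset wf_acyclic by blast
qed

text \<open>Along a cycle \<open>f\<close> must be constant because \<open>S\<close> is acyclic, so
  the cycle would lie in one fibre. The lexicographic order turns this into a well-foundedness
  argument.\<close>

lemma acyclic_quotient:
  assumes "finite R" "acyclic S" "finite S"
    and "\<And>u v. (u, v) \<in> R \<Longrightarrow> f u \<noteq> f v \<Longrightarrow> (f u, f v) \<in> S"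
    and "acyclic {(u, v) \<in> R. f u = f v}"
  shows "acyclic R"
proof -
  let ?T = "{(u, v) \<in> R. f u = f v}"
  have "wf (inv_image (S <*lex*> ?T) (\<lambda>u. (f u, u)))"
    using assms
      by (intro wf_inv_image wf_lex_prod finite_acyclic_wf) (auto elim: finite_subset[rotated])
  moreover have "R \<subseteq> inv_image (S <*lex*> ?T) (\<lambda>u. (f u, u))"
    using assms(4) by (auto simp: inv_image_def)
  ultimately show ?thesis using wf_subset wf_acyclic by blast
qed

lemma acyclic_monochr_iff: "acyclic (monochr \<phi> A) \<longleftrightarrow> (\<forall>c. acyclic (Restr A {v. \<phi> v = c}))"
proof
  show "\<forall>c. acyclic (Restr A {v. \<phi> v = c})" if "acyclic (monochr \<phi> A)"
    using that by (auto simp: monochr_def elim!: acyclic_subset)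
next
  assume *: "\<forall>c. acyclic (Restr A {v. \<phi> v = c})"
  have "\<phi> u = \<phi> v \<and> (u, v) \<in> (Restr A {v. \<phi> v = \<phi> u})\<^sup>+" if "(u, v) \<in> (monochr \<phi> A)\<^sup>+" for u v
    using that
  proof induction
    case (base v) then show ?case by (auto simp: monochr_def)
  next
    case (step v w)
    then have "\<phi> w = \<phi> u" "(v, w) \<in> Restr A {v. \<phi> v = \<phi> u}" by (auto simp: monochr_def)
    with step show ?case by (metis trancl.trancl_into_trancl)
  qed
  with * show "acyclic (monochr \<phi> A)" unfolding acyclic_def by blast
qed

lemma Restr_converse: "Restr (R\<inverse>) X = (Restr R X)\<inverse>"
  by auto

text \<open>The new vertex is a sink, so no cycle passes through it. Colour classes are extended
  greedily in this form.\<close>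

lemma acyclic_insert_sink:
  assumes "finite R" "acyclic (Restr R C)" "\<And>y. (x, y) \<in> R \<Longrightarrow> y \<noteq> x \<and> y \<notin> C"
  shows "acyclic (Restr R (insert x C))"
proof (rule acyclic_cut[of _ "{x}"])
  have "Restr (Restr R (insert x C)) {x} = {}" using assms(3) by blast
  then show "acyclic (Restr (Restr R (insert x C)) {x})" by (simp add: acyclic_def)
  show "acyclic (Restr (Restr R (insert x C)) (- {x}))"
    by (rule acyclic_subset[OF assms(2)]) auto
qed (use assms in auto)

lemma critical_not_colourable: "critical m F \<Longrightarrow> \<not> colourable m F"
  unfolding critical_def by (rule conjunct1)

lemma complete_on_insert:
  "x \<notin> X \<Longrightarrow> complete_on (insert x X) = complete_on X \<union> {x} \<times> X \<union> X \<times> {x}"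
  by (auto simp: complete_on_def)

lemma complete_on_mono: "X \<subseteq> Y \<Longrightarrow> complete_on X \<subseteq> complete_on Y"
  by (auto simp: complete_on_def)

lemma Field_complete_on:
  assumes "2 \<le> card X"
  shows "Field (complete_on X) = X"
proof
  show "Field (complete_on X) \<subseteq> X" by (auto simp: Field_def complete_on_def)
  show "X \<subseteq> Field (complete_on X)"
  proof
    fix x assume x: "x \<in> X"
    have "\<not> X \<subseteq> {x}" using assms card_mono[of "{x}" X] by auto
    then obtain y where "y \<in> X" "y \<noteq> x" by auto
    then have "(x, y) \<in> complete_on X" using x by (simp add: complete_on_def)
    then show "x \<in> Field (complete_on X)" by (rule FieldI1)
  qed
qed

section \<open>Out-degrees and arc counts\<close>

definition outdeg :: "'a rel \<Rightarrow> 'a \<Rightarrow> nat" where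
  "outdeg A v = card (A `` {v})"

lemma card_arcs_from:
  assumes "finite A" "finite X"
  shows "card (A \<inter> X \<times> UNIV) = (\<Sum>v\<in>X. outdeg A v)"
proof -
  have "A \<inter> X \<times> UNIV = (SIGMA v:X. A `` {v})" by auto
  moreover have "finite (A `` {v})" for v using assms(1) by (rule finite_Image)
  ultimately show ?thesis using assms(2) by (simp add: outdeg_def)
qed

lemma card_arcs_split:
  assumes "finite A"
  shows "card A = card (Restr A X) + card (A \<inter> X \<times> (- X)) + (\<Sum>v\<in>Field A - X. outdeg A v)"
proof -
  have "A = Restr A X \<union> A \<inter> X \<times> (- X) \<union> A \<inter> (Field A - X) \<times> UNIV"
    by (auto simp: Field_def)
  then have "card A = card (Restr A X \<union> A \<inter> X \<times> (- X)) + card (A \<inter> (Field A - X) \<times> UNIV)"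
    using assms by (subst card_Un_disjoint[symmetric]) auto
  also have "card (Restr A X \<union> A \<inter> X \<times> (- X)) = card (Restr A X) + card (A \<inter> X \<times> (- X))"
    using assms by (intro card_Un_disjoint) auto
  finally show ?thesis using assms by (simp add: card_arcs_from finite_Field)
qed

lemma colourable_empty: "0 < m \<Longrightarrow> colourable m {}"
  unfolding colourable_def by (intro exI[of _ "\<lambda>_. 0"]) (simp add: monochr_def acyclic_def)

lemma acyclic_single: "x \<noteq> y \<Longrightarrow> acyclic {(x, y)}"
  by (rule wf_acyclic, rule wf_subset[of "measure (\<lambda>v. if v = y then 1 else 0)"]) auto

text \<open>Here \<open>F\<close> arises from \<open>A\<close> by merging \<open>y\<close> into
  \<open>x\<close>: sending \<open>y\<close> to \<open>x\<close> maps the out-neighbours of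
  \<open>p\<close> in \<open>A\<close> onto those in \<open>F\<close>.\<close>

lemma outdeg_le_pullback:
  assumes "finite A" "\<And>q. (p, q) \<in> F \<Longrightarrow> q \<noteq> x \<Longrightarrow> (p, q) \<in> A"
    and "(p, x) \<in> F \<Longrightarrow> (p, x) \<in> A \<or> (p, y) \<in> A" and "y \<notin> Field F"
  shows "outdeg F p \<le> card (A `` {p} \<inter> insert y (insert x (Field F)))"
proof -
  have sub: "F `` {p} \<subseteq> (\<lambda>q. if q = y then x else q) ` (A `` {p} \<inter> insert y (insert x (Field F)))"
  proof
    fix q assume "q \<in> F `` {p}"
    then have q: "(p, q) \<in> F" "q \<in> Field F" "q \<noteq> y" using assms(4) by (auto intro: FieldI2)
    then show "q \<in> (\<lambda>q. if q = y then x else q) ` (A `` {p} \<inter> insert y (insert x (Field F)))"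
      using assms(2)[of q] assms(3) by (cases "q = x") force+
  qed
  have "finite (A `` {p} \<inter> insert y (insert x (Field F)))"
    using assms(1) by (simp add: finite_Image)
  then show ?thesis unfolding outdeg_def using sub by (rule surj_card_le)
qed

text \<open>
  The members of \<open>\<D>\<^sub>k\<close> for \<open>k = m + 1\<close>: the parts of the substitution are, in cyclic order,
  \<open>S\<close>, \<open>{a}\<close>, \<open>B\<close>, \<open>C\<close>, \<open>{b}\<close>.
\<close>

definition dirac_digraph :: "nat \<Rightarrow> 'a rel \<Rightarrow> bool" where
  "dirac_digraph m A \<longleftrightarrow> (\<exists>S a b B C. card S = m - 1 \<and> card (B \<union> C) = m \<and> B \<noteq> {} \<and> C \<noteq> {} \<and>
     a \<noteq> b \<and> B \<inter> C = {} \<and> S \<inter> (B \<union> C) = {} \<and> {a, b} \<inter> (S \<union> B \<union> C) = {} \<and>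
     A = complete_on (insert a S) \<union> complete_on (insert b S) \<union> complete_on (B \<union> C) \<union>
       complete_on (insert a B) \<union> complete_on (insert b C))"

text \<open>The cliques are \<open>insert a S\<close> and \<open>B \<union> C\<close>. Apart from
  the number of arcs, this is all that the induction retains of the exceptional family: one of the
  two cliques avoids any given vertex.\<close>

lemma dirac_disjoint_cliques:
  assumes "dirac_digraph m A" "3 \<le> m"
  shows "\<exists>P Q. P \<inter> Q = {} \<and> card P = m \<and> card Q = m \<and> complete_on P \<subseteq> A \<and> complete_on Q \<subseteq> A"
proof -
  from assms(1) obtain S a b B C where D: "card S = m - 1" "card (B \<union> C) = m" "B \<noteq> {}" "C \<noteq> {}"
    "a \<noteq> b" "B \<inter> C = {}" "S \<inter> (B \<union> C) = {}" "{a, b} \<inter> (S \<union> B \<union> C) = {}"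
    "A = complete_on (insert a S) \<union> complete_on (insert b S) \<union> complete_on (B \<union> C) \<union>
       complete_on (insert a B) \<union> complete_on (insert b C)"
    unfolding dirac_digraph_def by metis
  have "finite S" using D(1) assms(2) by (intro card_ge_0_finite) simp
  then have "card (insert a S) = m" using D(1,8) assms(2) by simp
  moreover have "insert a S \<inter> (B \<union> C) = {}" using D(7,8) by auto
  ultimately show ?thesis using D(2,9) by (intro exI[of _ "insert a S"] exI[of _ "B \<union> C"]) auto
qed

section \<open>Critical relations\<close>

locale critical_digraph =
  fixes A :: "'a rel" and m :: nat
  assumes fin: "finite A" and loopfree: "(v, v) \<notin> A" and crit: "critical m A" and m_pos: "0 < m"
begin

abbreviation "V \<equiv> Field A"

lemma finV [simp]: "finite V"
  using fin by (rule finite_Field)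

lemma critical_digraph_converse: "critical_digraph (A\<inverse>) m"
  using fin loopfree crit m_pos by unfold_locales auto

lemma no_colouring: "(\<And>v. \<phi> v < m) \<Longrightarrow> \<not> acyclic (monochr \<phi> A)"
  using crit unfolding critical_def colourable_def by blast

lemma colourable_Restr: "\<not> V \<subseteq> X \<Longrightarrow> colourable m (Restr A X)"
proof -
  assume "\<not> V \<subseteq> X"
  then have "Restr A X \<subset> A" by (auto simp: Field_def)
  then show ?thesis using crit by (simp add: critical_def)
qed

text \<open>
  A fixed colouring of the complement, shifted cyclically by each of the \<open>m\<close> colours, must produce a
  monochromatic arc leaving \<open>X\<close>, and each arc accounts for a single shift.
\<close>

lemma cut:
  assumes "X \<inter> V \<noteq> {}" "\<not> V \<subseteq> X"
  shows "m \<le> card (A \<inter> X \<times> (- X))"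
proof -
  obtain \<phi> \<psi> where \<phi>: "\<And>v. \<phi> v < m" "acyclic (monochr \<phi> (Restr A X))"
    and \<psi>: "\<And>v. \<psi> v < m" "acyclic (monochr \<psi> (Restr A (- X)))"
    using colourable_Restr[of X] colourable_Restr[of "- X"] assms unfolding colourable_def by blast
  \<comment> \<open>The shift at which the ends of the arc receive equal colours; adding
    \<open>m - \<psi> v\<close> stands for subtracting \<open>\<psi> v\<close> modulo
    \<open>m\<close>.\<close>
  define f where "f = (\<lambda>(u, v). (\<phi> u + (m - \<psi> v)) mod m)"
  have "j \<in> f ` (A \<inter> X \<times> (- X))" if j: "j < m" for j
  proof -
    let ?\<chi> = "\<lambda>v. if v \<in> X then \<phi> v else (\<psi> v + j) mod m"
    have "\<not> acyclic (monochr ?\<chi> A)"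
      using \<phi>(1) m_pos by (intro no_colouring) simp
    moreover have "Restr (monochr ?\<chi> A) X = monochr \<phi> (Restr A X)"
      by (auto simp: monochr_def)
    moreover have "\<psi> u = \<psi> v" if "(\<psi> u + j) mod m = (\<psi> v + j) mod m" for u v
    proof -
      have "((\<psi> u + j) mod m + (m - j)) mod m = ((\<psi> v + j) mod m + (m - j)) mod m"
        using that by simp
      then have "(\<psi> u + m) mod m = (\<psi> v + m) mod m"
        using j unfolding mod_add_left_eq by simp
      then show ?thesis using \<psi>(1) by simp
    qed
    then have "Restr (monochr ?\<chi> A) (- X) \<subseteq> monochr \<psi> (Restr A (- X))"
      by (auto simp: monochr_def)
    ultimately have "monochr ?\<chi> A \<inter> X \<times> (- X) \<noteq> {}"
      using \<phi>(2) \<psi>(2) fin acyclic_cut[of "monochr ?\<chi> A" X]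
      by (metis (no_types, lifting) acyclic_subset finite_subset monochr_subset)
    then obtain u v where uv: "(u, v) \<in> A" "u \<in> X" "v \<notin> X" "\<phi> u = (\<psi> v + j) mod m"
      by (auto simp: monochr_def)
    have "f (u, v) = (\<psi> v + j + (m - \<psi> v)) mod m"
      using uv by (simp add: f_def mod_add_left_eq)
    also have "\<dots> = j" using \<psi>(1)[of v] j by simp
    finally show ?thesis using uv by force
  qed
  then have "card {..<m} \<le> card (f ` (A \<inter> X \<times> (- X)))"
    using fin by (intro card_mono) auto
  also have "\<dots> \<le> card (A \<inter> X \<times> (- X))"
    using fin by (intro card_image_le) auto
  finally show ?thesis by simp
qed

lemma outdeg_ge: "v \<in> V \<Longrightarrow> m \<le> outdeg A v"
proof -
  assume v: "v \<in> V"
  then obtain b where "(v, b) \<in> A \<or> (b, v) \<in> A" by (auto simp: Field_def)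
  then have "b \<in> V" "b \<noteq> v" using loopfree by (auto simp: Field_def)
  then have "m \<le> card (A \<inter> {v} \<times> (- {v}))" using v by (intro cut) auto
  also have "A \<inter> {v} \<times> (- {v}) = Pair v ` (A `` {v})" using loopfree by auto
  also have "card \<dots> = outdeg A v" by (simp add: card_image inj_on_def outdeg_def)
  finally show ?thesis .
qed

text \<open>
  In an \<open>m\<close>-colouring of \<open>A - v\<close>, the \<open>m\<close> out-neighbours of \<open>v\<close> use all colours, so identifying
  \<open>y\<close> with \<open>x\<close> leaves no \<open>m\<close>-colouring; \<open>F\<close> is a critical part of the result.
\<close>

lemma contraction:
  assumes v: "outdeg A v = m" "(v, x) \<in> A" "(v, y) \<in> A" and xy: "x \<noteq> y" "(x, y) \<notin> A \<or> (y, x) \<notin> A"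
  obtains F where "critical_digraph F m" "x \<in> Field F" "insert y (Field F) \<subseteq> V - {v}" "y \<notin> Field F"
    "card F \<le> card (Restr A (insert y (Field F)))"
    "\<And>p q. (p, q) \<in> F \<Longrightarrow> p \<noteq> x \<Longrightarrow> q \<noteq> x \<Longrightarrow> (p, q) \<in> A"
    "\<And>q. (x, q) \<in> F \<Longrightarrow> (x, q) \<in> A \<or> (y, q) \<in> A"
    "\<And>p. (p, x) \<in> F \<Longrightarrow> (p, x) \<in> A \<or> (p, y) \<in> A"
proof -
  define \<pi> where "\<pi> u = (if u = y then x else u)" for u
  \<comment> \<open>Subtracting \<open>Id\<close> removes the loop that an arc between
    \<open>x\<close> and \<open>y\<close> would become.\<close>
  define H where "H = map_prod \<pi> \<pi> ` Restr A (- {v}) - Id"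
  have "finite H" using fin by (auto simp: H_def)
  have "\<not> colourable m H"
  proof
    assume "colourable m H"
    then obtain \<phi> where \<phi>: "\<And>v. \<phi> v < m" "acyclic (monochr \<phi> H)"
      unfolding colourable_def by auto
    define \<psi> where "\<psi> u = \<phi> (\<pi> u)" for u
    \<comment> \<open>As \<open>x\<close> and \<open>y\<close> share a colour, the \<open>m\<close>
      out-neighbours of \<open>v\<close> show at most \<open>m - 1\<close> colours, and some
      \<open>c\<close> is left for \<open>v\<close>.\<close>
    have "card (\<psi> ` (A `` {v})) < card {..<m}"
    proof -
      have "\<psi> y = \<psi> x" by (simp add: \<psi>_def \<pi>_def)
      moreover have "x \<in> A `` {v} - {y}" using v(2) xy(1) by auto
      ultimately have "\<psi> y \<in> \<psi> ` (A `` {v} - {y})" by simp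
      then have "\<psi> ` (A `` {v}) \<subseteq> \<psi> ` (A `` {v} - {y})" by auto
      then have "card (\<psi> ` (A `` {v})) \<le> card (A `` {v} - {y})"
        using fin by (intro surj_card_le) (auto simp: finite_Image)
      also have "\<dots> < card (A `` {v})"
        using v(3) fin by (intro card_Diff1_less) (auto simp: finite_Image)
      finally show ?thesis using v(1) by (simp add: outdeg_def)
    qed
    then have "\<not> {..<m} \<subseteq> \<psi> ` (A `` {v})"
      using fin by (meson card_mono finite_Image finite_imageI not_le)
    then obtain c where c: "c < m" "c \<notin> \<psi> ` (A `` {v})" by auto
    let ?\<chi> = "\<psi>(v := c)"
    have "acyclic (monochr \<psi> (Restr A (- {v})))"
    proof (rule acyclic_quotient[where f = \<pi> and S = "monochr \<phi> H"])
      show "finite (monochr \<psi> (Restr A (- {v})))" "finite (monochr \<phi> H)"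
        using fin \<open>finite H\<close> by (auto intro: finite_subset[OF monochr_subset])
      show "(\<pi> p, \<pi> q) \<in> monochr \<phi> H" if "(p, q) \<in> monochr \<psi> (Restr A (- {v}))" "\<pi> p \<noteq> \<pi> q" for p q
        using that by (auto simp: monochr_def H_def \<psi>_def)
      \<comment> \<open>Only the fibre consisting of \<open>x\<close> and \<open>y\<close> can
        contain an arc, and by assumption it does not contain a digon.\<close>
      let ?K = "{(p, q) \<in> monochr \<psi> (Restr A (- {v})). \<pi> p = \<pi> q}"
      have "?K \<subseteq> A \<inter> {(x, y), (y, x)}"
        using loopfree by (auto simp: monochr_def \<pi>_def split: if_splits)
      then have "?K \<subseteq> {(x, y)} \<or> ?K \<subseteq> {(y, x)}" using xy(2) by fastforce
      then show "acyclic ?K"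
        by (rule disjE) (erule acyclic_subset[OF acyclic_single, rotated], metis xy(1))+
    qed (rule \<phi>(2))
    then have 3: "acyclic (Restr (monochr ?\<chi> A) (- {v}))"
      by (rule acyclic_subset) (auto simp: monochr_def)
    have "Restr (monochr ?\<chi> A) {v} = {}" using loopfree by (auto simp: monochr_def)
    then have 2: "acyclic (Restr (monochr ?\<chi> A) {v})" by (simp only: acyclic_def trancl_empty) simp
    have 4: "monochr ?\<chi> A \<inter> {v} \<times> (- {v}) = {}"
      using c(2) by (auto simp: monochr_def)
    have "finite (monochr ?\<chi> A)" using monochr_subset fin by (rule finite_subset)
    then have "acyclic (monochr ?\<chi> A)" using 2 3 4 by (rule acyclic_cut)
    moreover have "?\<chi> u < m" for u using \<phi>(1) c(1) by (simp add: \<psi>_def)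
    ultimately show False using no_colouring by auto
  qed
  from ex_critical_subset[OF \<open>finite H\<close> this]
  obtain F where F: "F \<subseteq> H" "critical m F" by auto
  have H: "p \<noteq> q \<and> (\<exists>p' q'. (p', q') \<in> A \<and> p' \<noteq> v \<and> q' \<noteq> v \<and> p = \<pi> p' \<and> q = \<pi> q')" if "(p, q) \<in> H"
    for p q
    using that by (auto simp: H_def)
  have xv: "x \<noteq> v" "y \<noteq> v" using v loopfree by auto
  have arcs: "(p, q) \<in> F \<Longrightarrow> p \<noteq> x \<Longrightarrow> q \<noteq> x \<Longrightarrow> (p, q) \<in> A"
    "(x, q) \<in> F \<Longrightarrow> (x, q) \<in> A \<or> (y, q) \<in> A"
    "(p, x) \<in> F \<Longrightarrow> (p, x) \<in> A \<or> (p, y) \<in> A" for p q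
    using H[OF subsetD[OF F(1)]] by (fastforce simp: \<pi>_def split: if_splits)+
  have FV: "Field F \<subseteq> V - {v, y}"
  proof
    fix u assume "u \<in> Field F"
    then obtain u' where "(u, u') \<in> F \<or> (u', u) \<in> F" by (auto simp: Field_def)
    then obtain u' where "u' \<in> V - {v}" "u = \<pi> u'"
      using H[OF subsetD[OF F(1)]] by (fastforce intro: FieldI1 FieldI2)
    moreover have "x \<in> V" using v(2) by (auto intro: FieldI2)
    ultimately show "u \<in> V - {v, y}" using xv xy(1) by (auto simp: \<pi>_def)
  qed
  have xF: "x \<in> Field F"
  proof (rule ccontr)
    assume "x \<notin> Field F"
    then have "F \<subseteq> Restr A (- {v})"
      using arcs(1) FV by (auto intro: FieldI1 FieldI2) (metis FieldI1 FieldI2)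
    moreover have "\<not> V \<subseteq> - {v}" using v(2) by (auto intro: FieldI1)
    ultimately have "colourable m F" using colourable_mono[OF colourable_Restr] by metis
    then show False using critical_not_colourable[OF F(2)] by contradiction
  qed
  have "F \<subseteq> map_prod \<pi> \<pi> ` Restr A (insert y (Field F))"
  proof clarify
    fix p q assume pq: "(p, q) \<in> F"
    then obtain p' q' where *: "(p', q') \<in> A" "p = \<pi> p'" "q = \<pi> q'"
      using H[OF subsetD[OF F(1) pq]] by auto
    have "p \<in> Field F" "q \<in> Field F" using pq by (auto intro: FieldI1 FieldI2)
    then have "(p', q') \<in> Restr A (insert y (Field F))"
      using * by (auto simp: \<pi>_def split: if_splits)
    then show "(p, q) \<in> map_prod \<pi> \<pi> ` Restr A (insert y (Field F))" using * by force
  qed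
  then have card: "card F \<le> card (Restr A (insert y (Field F)))"
    using fin by (intro surj_card_le) auto
  have "critical_digraph F m"
  proof
    show "finite F" using F(1) \<open>finite H\<close> by (rule finite_subset)
    show "(u, u) \<notin> F" for u using F(1) by (auto simp: H_def)
  qed (use F(2) m_pos in auto)
  moreover have "y \<in> V" using v(3) by (auto intro: FieldI2)
  ultimately show ?thesis using that[OF _ xF _ _ card arcs] FV xv by auto
qed

end

section \<open>Critical relations with few arcs\<close>

text \<open>\<open>sparse\<close> negates the bound to be proved. \<open>IH\<close> is the induction
  hypothesis, with the exceptional family weakened to two disjoint cliques and a number of arcs. It
  refers to \<open>A\<close> only through the number of vertices, so it survives reversal of all
  arcs.\<close>

locale sparse_critical_digraph = critical_digraph A m for A :: "'a rel" and m +
  assumes m3: "3 \<le> m"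
    and sparse: "card A \<le> m * card V + m - 2"
    and no_clique: "complete_on X \<subseteq> A \<Longrightarrow> card X \<noteq> m + 1"
    and IH: "finite (F :: 'a rel) \<Longrightarrow> (\<And>v. (v, v) \<notin> F) \<Longrightarrow> critical m F \<Longrightarrow> card (Field F) < card V \<Longrightarrow>
      F = complete_on (Field F) \<and> card (Field F) = m + 1 \<or>
      (\<exists>P Q. P \<inter> Q = {} \<and> card P = m \<and> card Q = m \<and> complete_on P \<subseteq> F \<and> complete_on Q \<subseteq> F) \<and>
        m * card (Field F) + m - 2 \<le> card F \<or>
      m * card (Field F) + m - 1 \<le> card F"
begin

text \<open>In-degrees are written as out-degrees of the converse, so interpreting the locale there
  transfers every result about outgoing arcs to incoming ones.\<close>

lemma sparse_critical_digraph_converse: "sparse_critical_digraph (A\<inverse>) m"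
proof -
  interpret conv: critical_digraph "A\<inverse>" m by (rule critical_digraph_converse)
  show ?thesis
  proof
    show "card (A\<inverse>) \<le> m * card (Field (A\<inverse>)) + m - 2" using sparse by simp
    show "card X \<noteq> m + 1" if "complete_on X \<subseteq> A\<inverse>" for X
    proof -
      have "(complete_on X)\<inverse> \<subseteq> A" using that by blast
      then show ?thesis using no_clique by simp
    qed
  qed (use m3 IH in auto)
qed

section \<open>Excess of out-degrees and sparsity of vertex sets\<close>

lemma sum_outdeg: "(\<Sum>v\<in>V. outdeg A v) = card A"
proof -
  have "A \<inter> V \<times> UNIV = A" by (auto simp: Field_def)
  then show ?thesis using card_arcs_from[OF fin finV] by simp
qed

text \<open>The excesses over \<open>m\<close> add up to at most \<open>m - 2\<close>, and by
  \<open>outdeg_ge\<close> the vertices outside \<open>S\<close> cannot contribute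
  negatively.\<close>

lemma excess_le:
  assumes "S \<subseteq> V" "\<And>v. v \<in> S \<Longrightarrow> m + g v \<le> outdeg A v"
  shows "sum g S \<le> m - 2"
proof -
  have "(\<Sum>v\<in>V. outdeg A v) = (\<Sum>v\<in>S. outdeg A v) + (\<Sum>v\<in>V - S. outdeg A v)"
    using assms(1) finV by (metis add.commute sum.subset_diff)
  moreover have "(\<Sum>v\<in>S. m + g v) \<le> (\<Sum>v\<in>S. outdeg A v)" by (intro sum_mono assms)
  moreover have "(\<Sum>v\<in>V - S. m) \<le> (\<Sum>v\<in>V - S. outdeg A v)" by (intro sum_mono outdeg_ge) auto
  moreover have "card V = card S + card (V - S)"
    using assms(1) finV by (metis card_mono card_Diff_subset finite_subset le_add_diff_inverse)
  ultimately show ?thesis using sparse sum_outdeg by (simp add: sum.distrib algebra_simps)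
qed

text \<open>Count arcs by their tails: at least \<open>m\<close> arcs leave \<open>X\<close>, and
  each vertex outside \<open>X\<close> is the tail of at least \<open>m\<close> arcs. In the
  extremal case none of these bounds has any slack.\<close>

lemma Restr_le:
  assumes "X \<subseteq> V" "X \<noteq> {}" "X \<noteq> V"
  shows "card (Restr A X) + 2 \<le> m * card X"
    and "m * card X \<le> card (Restr A X) + 2 \<Longrightarrow>
      card A = m * card V + m - 2 \<and> card (A \<inter> X \<times> (- X)) = m \<and> (\<forall>v\<in>V - X. outdeg A v = m)"
proof -
  have cut: "m \<le> card (A \<inter> X \<times> (- X))" using assms by (intro cut) auto
  have split: "card A = card (Restr A X) + card (A \<inter> X \<times> (- X)) + (\<Sum>v\<in>V - X. outdeg A v)"
    using fin by (rule card_arcs_split)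
  have cV: "card V = card X + card (V - X)"
    using assms(1) finV by (metis card_mono card_Diff_subset finite_subset le_add_diff_inverse)
  have outdeg: "(\<Sum>v\<in>V - X. m) \<le> (\<Sum>v\<in>V - X. outdeg A v)" by (intro sum_mono outdeg_ge) auto
  have *: "card (Restr A X) + card (A \<inter> X \<times> (- X)) + (\<Sum>v\<in>V - X. outdeg A v)
      \<le> m * card X + (\<Sum>v\<in>V - X. m) + (m - 2)"
    using sparse m3 unfolding split[symmetric] by (simp add: cV algebra_simps)
  then show "card (Restr A X) + 2 \<le> m * card X" using cut outdeg m3 by linarith
  assume tight: "m * card X \<le> card (Restr A X) + 2"
  then have c: "card (A \<inter> X \<times> (- X)) = m" and s: "(\<Sum>v\<in>V - X. outdeg A v) = (\<Sum>v\<in>V - X. m)"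
    using * cut outdeg m3 by linarith+
  have "outdeg A v = m" if "v \<in> V - X" for v
  proof (rule ccontr)
    assume "outdeg A v \<noteq> m"
    then have "(\<Sum>v\<in>V - X. m) < (\<Sum>v\<in>V - X. outdeg A v)"
      using outdeg_ge that
        by (intro sum_strict_mono_ex1) (auto intro!: bexI[of _ v] simp: le_neq_trans)
    with s show False by simp
  qed
  moreover have "card (Restr A X) + 2 = m * card X"
    using tight * cut outdeg m3 by linarith
  then have "card A = m * card V + m - 2"
    using split c s m3 by (simp add: cV algebra_simps)
  ultimately show "card A = m * card V + m - 2 \<and> card (A \<inter> X \<times> (- X)) = m \<and> (\<forall>v\<in>V - X. outdeg A v = m)"
    using c by blast
qed

lemma Restr_tight:
  assumes "X \<subseteq> V" "X \<noteq> {}" "X \<noteq> V" "m * card X \<le> card (Restr A X) + 2"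
  shows "card A = m * card V + m - 2" "card (A \<inter> X \<times> (- X)) = m" "card (A \<inter> (- X) \<times> X) = m"
    "\<forall>v\<in>V - X. outdeg A v = m \<and> outdeg (A\<inverse>) v = m"
proof -
  interpret conv: sparse_critical_digraph "A\<inverse>" m by (rule sparse_critical_digraph_converse)
  have X': "X \<subseteq> conv.V" "X \<noteq> {}" "X \<noteq> conv.V" using assms by auto
  have "card (Restr (A\<inverse>) X) = card (Restr A X)" by (simp only: Restr_converse card_inverse)
  then have tight': "card (A\<inverse> \<inter> X \<times> (- X)) = m \<and> (\<forall>v\<in>conv.V - X. outdeg (A\<inverse>) v = m)"
    using conv.Restr_le(2)[OF X'] assms(4) by simp
  have "A\<inverse> \<inter> X \<times> (- X) = (A \<inter> (- X) \<times> X)\<inverse>" by auto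
  then have "card (A\<inverse> \<inter> X \<times> (- X)) = card (A \<inter> (- X) \<times> X)" by (simp only: card_inverse)
  then show "card A = m * card V + m - 2" "card (A \<inter> X \<times> (- X)) = m" "card (A \<inter> (- X) \<times> X) = m"
    "\<forall>v\<in>V - X. outdeg A v = m \<and> outdeg (A\<inverse>) v = m"
    using Restr_le(2)[OF assms] tight' by auto
qed

section \<open>Cliques of order \<open>m\<close> and extension of colourings\<close>

definition clique :: "'a set \<Rightarrow> bool" where
  "clique Q \<longleftrightarrow> card Q = m \<and> complete_on Q \<subseteq> A"

context
  fixes Q assumes Q: "clique Q"
begin

lemma finite_clique: "finite Q"
  using Q m3 by (metis card.infinite clique_def not_numeral_le_zero)

lemma clique_arc: "x \<in> Q \<Longrightarrow> y \<in> Q \<Longrightarrow> x \<noteq> y \<Longrightarrow> (x, y) \<in> A"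
  using Q by (auto simp: clique_def complete_on_def)

lemma clique_subset: "Q \<subseteq> V"
proof
  fix x assume x: "x \<in> Q"
  have "\<not> Q \<subseteq> {x}" using Q m3 card_mono[of "{x}" Q] by (auto simp: clique_def)
  then obtain y where "y \<in> Q" "y \<noteq> x" by blast
  then show "x \<in> V" using clique_arc x by (auto intro: FieldI1)
qed

text \<open>In particular a vertex of out-degree \<open>m\<close> has exactly one out-neighbour
  outside \<open>Q\<close>.\<close>

lemma outdeg_clique: "x \<in> Q \<Longrightarrow> outdeg A x = m - 1 + card (A `` {x} - Q)"
proof -
  assume x: "x \<in> Q"
  have "A `` {x} = (Q - {x}) \<union> (A `` {x} - Q)" using clique_arc x loopfree by auto
  then have "outdeg A x = card ((Q - {x}) \<union> (A `` {x} - Q))" by (simp add: outdeg_def)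
  also have "\<dots> = card (Q - {x}) + card (A `` {x} - Q)"
    using finite_clique fin by (intro card_Un_disjoint) (auto simp: finite_Image)
  finally show ?thesis using x Q finite_clique by (simp add: clique_def)
qed

text \<open>
  If \<open>j\<close> vertices of \<open>Q\<close> violate Hall's condition, then each of them has at least \<open>m + 1 - j\<close>
  forbidden colours, hence out-degree at least \<open>2 m - j\<close>, and \<open>j (m - j) \<le> m - 2\<close> forces \<open>j = m\<close>.
\<close>

lemma clique_colouring:
  assumes \<phi>: "\<And>v. \<phi> v < m" "acyclic (monochr \<phi> (Restr A (- Q)))"
  shows "\<exists>c<m. \<forall>x\<in>Q. \<not> acyclic (Restr A (insert x {v. v \<notin> Q \<and> \<phi> v = c}))"
proof (rule ccontr)
  let ?C = "\<lambda>c. {v. v \<notin> Q \<and> \<phi> v = c}"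
  \<comment> \<open>The colours that \<open>x\<close> can take when it alone is added to the
    coloured complement of \<open>Q\<close>.\<close>
  define L where "L x = {c. c < m \<and> acyclic (Restr A (insert x (?C c)))}" for x
  assume "\<not> ?thesis"
  then have cov: "\<exists>x\<in>Q. c \<in> L x" if "c < m" for c
    using that by (auto simp: L_def)
  have acyc: "acyclic (Restr A (?C c))" for c
    by (rule acyclic_subset[OF \<phi>(2)]) (auto simp: monochr_def)
  have L: "L x \<subseteq> {..<m}" for x by (auto simp: L_def)
  then have finL: "finite (L x)" for x by (rule finite_subset) simp
  \<comment> \<open>Each forbidden colour occurs on an out-neighbour outside \<open>Q\<close>,
    besides the \<open>m - 1\<close> arcs inside. Truncated subtraction covers
    \<open>card (L x) = m\<close>, where \<open>outdeg_ge\<close> suffices.\<close>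
  have card_L: "m + (m - Suc (card (L x))) \<le> outdeg A x" if x: "x \<in> Q" for x
  proof -
    have "{..<m} - L x \<subseteq> \<phi> ` (A `` {x} - Q)"
    proof
      fix c assume c: "c \<in> {..<m} - L x"
      then have "\<not> acyclic (Restr A (insert x (?C c)))" by (auto simp: L_def)
      then have "\<exists>y. (x, y) \<in> A \<and> y \<in> ?C c"
        using acyclic_insert_sink[OF fin acyc, of x c] loopfree by blast
      then show "c \<in> \<phi> ` (A `` {x} - Q)" by auto
    qed
    then have "card ({..<m} - L x) \<le> card (A `` {x} - Q)"
      using fin by (intro surj_card_le) (auto simp: finite_Image)
    moreover have "card ({..<m} - L x) = m - card (L x)"
      using L finL by (simp add: card_Diff_subset)
    ultimately show ?thesis using outdeg_clique[OF x] outdeg_ge[of x] clique_subset x m3 by auto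
  qed
  have "card J \<le> card (\<Union>(L ` J))" if J: "J \<subseteq> Q" for J
  proof (cases "J = {} \<or> J = Q")
    case True
    have "{..<m} \<subseteq> \<Union>(L ` Q)" using cov by auto
    then have "card {..<m} \<le> card (\<Union>(L ` Q))" using finL finite_clique by (intro card_mono) auto
    then show ?thesis using True Q by (auto simp: clique_def)
  next
    case False
    show ?thesis
    proof (rule ccontr)
      assume small: "\<not> ?thesis"
      have finJ: "finite J" using J finite_clique finite_subset by blast
      have cJ: "1 \<le> card J" "card J < m"
        using False J Q finite_clique finJ psubset_card_mono[of Q J]
          by (auto simp: clique_def card_gt_0_iff Suc_le_eq)
      have "m + (m - card J) \<le> outdeg A x" if x: "x \<in> J" for x
      proof -
        have "card (L x) \<le> card (\<Union>(L ` J))" using finL finJ x by (intro card_mono) auto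
        then have "m - card J \<le> m - Suc (card (L x))" using small by simp
        then show ?thesis using card_L[of x] J x by force
      qed
      then have "(\<Sum>x\<in>J. m - card J) \<le> m - 2"
        using J clique_subset by (intro excess_le) auto
      \<comment> \<open>With \<open>card J = Suc j\<close> and \<open>m = Suc (card J + t)\<close>
        the sum equals \<open>(j + 1) * (t + 1)\<close>, which is at least
        \<open>j + t + 1 = m - 1\<close>.\<close>
      moreover obtain t where "m = Suc (card J + t)"
        using cJ(2) less_iff_Suc_add by auto
      moreover obtain j where "card J = Suc j" using cJ(1) by (metis Suc_le_D One_nat_def)
      ultimately show False by simp
    qed
  qed
  from hall_marriage[of Q L, OF finite_clique finL this]
  obtain f where f: "inj_on f Q" "\<And>x. x \<in> Q \<Longrightarrow> f x \<in> L x" by auto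
  \<comment> \<open>As \<open>f\<close> is injective, each colour class gains at most one vertex of
    \<open>Q\<close>, and for that one the colour is available.\<close>
  let ?\<chi> = "\<lambda>v. if v \<in> Q then f v else \<phi> v"
  have "acyclic (Restr A {v. ?\<chi> v = c})" for c
  proof (cases "\<exists>x\<in>Q. f x = c")
    case True
    then obtain x where x: "x \<in> Q" "f x = c" by blast
    then have "{v. ?\<chi> v = c} = insert x (?C c)"
      using f(1) by (auto split: if_splits dest: inj_onD)
    then show ?thesis using f(2)[OF x(1)] x(2) by (auto simp: L_def)
  next
    case False
    then have "{v. ?\<chi> v = c} = ?C c" by (auto split: if_splits)
    then show ?thesis using acyc by simp
  qed
  moreover have "?\<chi> v < m" for v using f(2) L \<phi>(1) by force
  ultimately show False using no_colouring[of ?\<chi>] by (simp add: acyclic_monochr_iff)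
qed

end

section \<open>Ends of a clique\<close>

definition ends :: "'a set \<Rightarrow> 'a set" where
  "ends Q = {w. w \<notin> Q \<and> (\<exists>x\<in>Q. outdeg A x = m \<and> (x, w) \<in> A \<or> outdeg (A\<inverse>) x = m \<and> (w, x) \<in> A)}"

lemma clique_converse: "sparse_critical_digraph.clique (A\<inverse>) m Q \<longleftrightarrow> clique Q"
proof -
  interpret conv: sparse_critical_digraph "A\<inverse>" m by (rule sparse_critical_digraph_converse)
  have "complete_on Q \<subseteq> A\<inverse> \<longleftrightarrow> complete_on Q \<subseteq> A"
    by (auto simp: complete_on_def subset_iff)
  then show ?thesis by (simp add: clique_def conv.clique_def)
qed

context
  fixes Q assumes Q: "clique Q"
begin

lemma ex_out_end:
  assumes "x \<in> Q" "outdeg A x = m"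
  shows "\<exists>w. A `` {x} - Q = {w}"
proof -
  have "card (A `` {x} - Q) = 1" using outdeg_clique[OF Q assms(1)] assms(2) m3 by linarith
  then show ?thesis by (rule card_1_singletonE) (rule exI)
qed

lemma out_end:
  assumes "x \<in> Q" "outdeg A x = m" "(x, w) \<in> A" "w \<notin> Q"
  shows "A `` {x} - Q = {w}"
proof -
  obtain w' where w': "A `` {x} - Q = {w'}" using ex_out_end assms(1,2) by metis
  have "w \<in> A `` {x} - Q" using assms(3,4) by simp
  with w' show ?thesis by simp
qed

lemma card_not_low: "card {x \<in> Q. outdeg A x \<noteq> m} \<le> m - 2"
proof -
  have "m + 1 \<le> outdeg A x" if "x \<in> {x \<in> Q. outdeg A x \<noteq> m}" for x
    using that outdeg_ge[of x] clique_subset[OF Q] by fastforce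
  then have "(\<Sum>x\<in>{x \<in> Q. outdeg A x \<noteq> m}. 1) \<le> m - 2"
    using clique_subset[OF Q] by (intro excess_le) auto
  then show ?thesis by simp
qed

text \<open>At most \<open>m - 2\<close> of the \<open>m\<close> vertices of \<open>Q\<close> have
  larger out-degree, so at least two have out-degree \<open>m\<close>, and one of them differs from
  \<open>y\<close>.\<close>

lemma ex_low: "\<exists>x\<in>Q. x \<noteq> y \<and> outdeg A x = m"
proof (rule ccontr)
  assume "\<not> ?thesis"
  then have "Q \<subseteq> insert y {x \<in> Q. outdeg A x \<noteq> m}" by auto
  then have "card Q \<le> card (insert y {x \<in> Q. outdeg A x \<noteq> m})"
    using finite_clique[OF Q] by (intro card_mono) auto
  also have "\<dots> \<le> Suc (card {x \<in> Q. outdeg A x \<noteq> m})"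
    using finite_clique[OF Q] by (simp add: card_insert_if)
  finally show False using Q m3 card_not_low by (simp add: clique_def)
qed

text \<open>\<open>w\<close> is the only out-neighbour of \<open>x\<close> outside \<open>Q\<close>;
  if its colour were not \<open>c\<close>, then \<open>x\<close> could join class \<open>c\<close>
  as a sink.\<close>

lemma out_end_colour:
  assumes "acyclic (monochr \<phi> (Restr A (- Q)))"
    and "\<not> acyclic (Restr A (insert x {v. v \<notin> Q \<and> \<phi> v = c}))"
    and "x \<in> Q" "outdeg A x = m" "(x, w) \<in> A" "w \<notin> Q"
  shows "\<phi> w = c"
proof (rule ccontr)
  assume *: "\<phi> w \<noteq> c"
  have "acyclic (Restr A {v. v \<notin> Q \<and> \<phi> v = c})"
    by (rule acyclic_subset[OF assms(1)]) (auto simp: monochr_def)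
  moreover have "y \<noteq> x \<and> y \<notin> {v. v \<notin> Q \<and> \<phi> v = c}" if "(x, y) \<in> A" for y
  proof (cases "y \<in> Q")
    case False
    then have "y = w" using that out_end[OF assms(3-6)] by auto
    then show ?thesis using * assms(3,6) by auto
  qed (use that loopfree in auto)
  ultimately have "acyclic (Restr A (insert x {v. v \<notin> Q \<and> \<phi> v = c}))"
    by (rule acyclic_insert_sink[OF fin])
  with assms(2) show False by contradiction
qed

end

text \<open>Reversing all arcs preserves acyclic colour classes, so an end given by an incoming arc
  is treated in the converse.\<close>

lemma ends_colour:
  assumes Q: "clique Q" and \<phi>: "acyclic (monochr \<phi> (Restr A (- Q)))"
    and c: "\<And>x. x \<in> Q \<Longrightarrow> \<not> acyclic (Restr A (insert x {v. v \<notin> Q \<and> \<phi> v = c}))"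
    and w: "w \<in> ends Q"
  shows "\<phi> w = c"
proof -
  interpret conv: sparse_critical_digraph "A\<inverse>" m by (rule sparse_critical_digraph_converse)
  have Q': "conv.clique Q" using Q by (simp add: clique_converse)
  have \<phi>': "acyclic (monochr \<phi> (Restr (A\<inverse>) (- Q)))"
    using \<phi> by (simp only: Restr_converse monochr_converse acyclic_converse)
  have c': "\<not> acyclic (Restr (A\<inverse>) (insert x {v. v \<notin> Q \<and> \<phi> v = c}))" if "x \<in> Q" for x
    using c[OF that] by (simp only: Restr_converse acyclic_converse not_False_eq_True)
  from w obtain x where x: "x \<in> Q" "w \<notin> Q"
    "outdeg A x = m \<and> (x, w) \<in> A \<or> outdeg (A\<inverse>) x = m \<and> (w, x) \<in> A"
    by (auto simp: ends_def)
  from x(3) show ?thesis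
  proof
    assume "outdeg A x = m \<and> (x, w) \<in> A"
    then show ?thesis using out_end_colour[OF Q \<phi> c[OF x(1)] x(1)] x(2) by simp
  next
    assume "outdeg (A\<inverse>) x = m \<and> (w, x) \<in> A"
    then show ?thesis using conv.out_end_colour[OF Q' \<phi>' c'[OF x(1)] x(1)] x(2) by simp
  qed
qed

lemma ends_same_colour:
  assumes "clique Q" "\<And>v. \<phi> v < m" "acyclic (monochr \<phi> (Restr A (- Q)))" "a \<in> ends Q" "b \<in> ends Q"
  shows "\<phi> a = \<phi> b"
proof -
  obtain c where "\<forall>x\<in>Q. \<not> acyclic (Restr A (insert x {v. v \<notin> Q \<and> \<phi> v = c}))"
    using clique_colouring[OF assms(1-3)] by auto
  then have "\<phi> w = c" if "w \<in> ends Q" for w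
    by - (rule ends_colour[OF assms(1,3) _ that], erule bspec)
  then show ?thesis using assms(4,5) by simp
qed

lemma ends_subset: "clique Q \<Longrightarrow> ends Q \<subseteq> V - Q"
  by (auto simp: ends_def Field_def)

text \<open>Since \<open>a\<close> and \<open>b\<close> always share a colour, a digon between them
  makes the complement of \<open>Q\<close> uncolourable. A critical part \<open>F\<close> of the
  result has at most two arcs outside \<open>A\<close>; by sparsity only the complete digraph
  remains, and it makes the estimates for \<open>X\<close> tight.\<close>

lemma digon_clique:
  assumes Q: "clique Q" and ab: "a \<in> ends Q" "b \<in> ends Q" "a \<noteq> b"
  obtains X where "X \<subseteq> V - Q" "a \<in> X" "b \<in> X" "card X = m + 1"
    "Restr A X = complete_on X - {(a, b), (b, a)}"
    "card A = m * card V + m - 2"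
    "card (A \<inter> X \<times> (- X)) = m" "card (A \<inter> (- X) \<times> X) = m"
    "\<forall>v\<in>V - X. outdeg A v = m \<and> outdeg (A\<inverse>) v = m"
proof -
  let ?D = "{(a, b), (b, a)}"
  define H where "H = Restr A (- Q) \<union> ?D"
  have ne: "Q \<noteq> {}" using Q m3 by (auto simp: clique_def)
  have "\<not> colourable m H"
  proof
    assume "colourable m H"
    then obtain \<phi> where \<phi>: "\<And>v. \<phi> v < m" "acyclic (monochr \<phi> H)"
      unfolding colourable_def by blast
    have "acyclic (monochr \<phi> (Restr A (- Q)))"
      using \<phi>(2) by (rule acyclic_subset) (auto simp: monochr_def H_def)
    then have "\<phi> a = \<phi> b" using ends_same_colour Q \<phi>(1) ab(1,2) by blast
    then have "(a, b) \<in> monochr \<phi> H" "(b, a) \<in> monochr \<phi> H" by (auto simp: monochr_def H_def)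
    then show False using \<phi>(2) acyclic_no_digon by metis
  qed
  have "finite H" using fin by (auto simp: H_def)
  from ex_critical_subset[OF this \<open>\<not> colourable m H\<close>]
  obtain F where F: "F \<subseteq> H" "critical m F" by blast
  define X where "X = Field F"
  have XVQ: "X \<subseteq> V - Q"
  proof -
    have "X \<subseteq> Field H" unfolding X_def using F(1) by (rule mono_Field)
    also have "\<dots> \<subseteq> V - Q" using ends_subset[OF Q] ab by (auto simp: Field_def H_def)
    finally show ?thesis .
  qed
  have sub: "F - ?D \<subseteq> Restr A X"
    using F(1) by (auto simp: X_def H_def intro: FieldI1 FieldI2)
  have notsub: "F \<inter> ?D \<noteq> {}"
  proof
    assume "F \<inter> ?D = {}"
    then have "F \<subseteq> Restr A X" using sub by auto
    moreover have "\<not> V \<subseteq> X" using XVQ ne clique_subset[OF Q] by blast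
    ultimately have "colourable m F"
      using colourable_mono[OF colourable_Restr] by blast
    then show False using critical_not_colourable[OF F(2)] by contradiction
  qed
  then have abX: "a \<in> X" "b \<in> X" by (auto simp: X_def Field_def)
  have finF: "finite F" using F(1) \<open>finite H\<close> by (rule finite_subset)
  have finX: "finite X" using finF by (simp add: X_def finite_Field)
  have XV: "X \<subseteq> V" "X \<noteq> {}" "X \<noteq> V" using XVQ abX ne clique_subset[OF Q] by auto
  have cF: "card F - 2 \<le> card (F - ?D)"
    using diff_card_le_card_Diff[of ?D F] ab(3) by simp
  moreover have "card (F - ?D) \<le> card (Restr A X)" using sub fin by (intro card_mono) auto
  ultimately have le: "card F \<le> m * card X" using Restr_le(1)[OF XV] by linarith
  have "card X < card V" using XV by (intro psubset_card_mono) auto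
  moreover have "(v, v) \<notin> F" for v using F(1) loopfree ab(3) by (auto simp: H_def)
  ultimately have K: "F = complete_on X" "card X = m + 1"
    using IH[OF finF _ F(2)] le m3 unfolding X_def by auto
  have "card F = m * card X" using K finX by (simp add: card_complete_on)
  then have "m * card X \<le> card (Restr A X) + 2"
    using cF \<open>card (F - ?D) \<le> card (Restr A X)\<close> by linarith
  note tight = Restr_tight[OF XV this]
  have "card (Restr A X) \<le> card (F - ?D)"
    using cF \<open>card F = m * card X\<close> Restr_le(1)[OF XV] by linarith
  then have "F - ?D = Restr A X" using sub fin by (intro card_seteq) auto
  then have R: "Restr A X = complete_on X - ?D" using K(1) by simp
  show ?thesis using that[OF XVQ abX K(2) R tight] .
qed

lemma clique_nonempty: "clique Q \<Longrightarrow> Q \<noteq> {}"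
  using m3 by (auto simp: clique_def)

lemma ends_no_digon:
  assumes Q: "clique Q" and pq: "p \<in> ends Q" "q \<in> ends Q" and A: "(p, q) \<in> A" "(q, p) \<in> A"
  shows False
proof -
  have "\<not> V \<subseteq> - Q" using clique_nonempty[OF Q] clique_subset[OF Q] by auto
  from colourable_Restr[OF this]
  obtain \<phi> where \<phi>: "\<And>v. \<phi> v < m" "acyclic (monochr \<phi> (Restr A (- Q)))"
    unfolding colourable_def by auto
  have "\<phi> p = \<phi> q" using ends_same_colour[OF Q \<phi> pq] .
  moreover have "p \<notin> Q" "q \<notin> Q" using ends_subset[OF Q] pq by auto
  ultimately have "(p, q) \<in> monochr \<phi> (Restr A (- Q))" "(q, p) \<in> monochr \<phi> (Restr A (- Q))"
    using A by (auto simp: monochr_def)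
  then show False using acyclic_no_digon[OF \<phi>(2)] by simp
qed

text \<open>Three ends give three nearly complete sets \<open>X\<close>, \<open>Y\<close>,
  \<open>Z\<close>. As \<open>a\<close> lies outside \<open>Z\<close>, it has degree
  \<open>m\<close> in both directions, which forces \<open>X\<close> and \<open>Y\<close> to agree
  apart from \<open>b\<close> and \<open>c\<close>. Then the \<open>m - 1\<close> vertices of
  \<open>X\<close> other than \<open>a\<close> and \<open>b\<close> all have positive excess, which
  is too much.\<close>

lemma ends_le_two:
  assumes Q: "clique Q" and abc: "a \<in> ends Q" "b \<in> ends Q" "c \<in> ends Q"
    and ne: "a \<noteq> b" "a \<noteq> c" "b \<noteq> c"
  shows False
proof -
  obtain X where X: "X \<subseteq> V - Q" "a \<in> X" "b \<in> X" "card X = m + 1"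
    "Restr A X = complete_on X - {(a, b), (b, a)}"
    "card A = m * card V + m - 2"
    "card (A \<inter> X \<times> (- X)) = m" "card (A \<inter> (- X) \<times> X) = m"
    "\<forall>v\<in>V - X. outdeg A v = m \<and> outdeg (A\<inverse>) v = m"
    using digon_clique[OF Q abc(1,2) ne(1)] .
  obtain Y where Y: "Y \<subseteq> V - Q" "a \<in> Y" "c \<in> Y" "card Y = m + 1"
    "Restr A Y = complete_on Y - {(a, c), (c, a)}"
    "card A = m * card V + m - 2"
    "card (A \<inter> Y \<times> (- Y)) = m" "card (A \<inter> (- Y) \<times> Y) = m"
    "\<forall>v\<in>V - Y. outdeg A v = m \<and> outdeg (A\<inverse>) v = m"
    using digon_clique[OF Q abc(1,3) ne(2)] .
  obtain Z where Z: "Z \<subseteq> V - Q" "b \<in> Z" "c \<in> Z" "card Z = m + 1"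
    "Restr A Z = complete_on Z - {(b, c), (c, b)}"
    "card A = m * card V + m - 2"
    "card (A \<inter> Z \<times> (- Z)) = m" "card (A \<inter> (- Z) \<times> Z) = m"
    "\<forall>v\<in>V - Z. outdeg A v = m \<and> outdeg (A\<inverse>) v = m"
    using digon_clique[OF Q abc(2,3) ne(3)] .
  have third: "r \<notin> W"
    if "Restr A W = complete_on W - {(p, q), (q, p)}" "p \<in> W" "p \<in> ends Q" "r \<in> ends Q" "r \<noteq> p" "r \<noteq> q"
    for p q r W
  proof
    assume "r \<in> W"
    then have "(p, r) \<in> Restr A W" "(r, p) \<in> Restr A W"
      using that by (simp_all only: that(1)) (auto simp: complete_on_def)
    then show False using ends_no_digon[OF Q that(3,4)] by auto
  qed
  have "a \<notin> Z" using third[OF Z(5,2)] abc ne by auto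
  moreover have "a \<in> V" using X by auto
  ultimately have low: "card (A `` {a}) = m" "card (A\<inverse> `` {a}) = m"
    using Z(9) by (auto simp: outdeg_def)
  let ?K = "X - {a, b}" and ?L = "Y - {a, c}"
  have fX: "finite X" "finite Y" using X(1) Y(1) finV by (meson finite_Diff finite_subset)+
  then have cK: "card ?K = m - 1" "card ?L = m - 1" using X Y ne by (simp_all add: card_Diff_subset)
  have arcs: "(u, v) \<in> A" if "u \<in> X" "v \<in> X" "u \<noteq> v" "(u, v) \<notin> {(a, b), (b, a)}" for u v
    using that X(5) by (auto simp: complete_on_def)
  have arcs': "(u, v) \<in> A" if "u \<in> Y" "v \<in> Y" "u \<noteq> v" "(u, v) \<notin> {(a, c), (c, a)}" for u v
    using that Y(5) by (auto simp: complete_on_def)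
  \<comment> \<open>\<open>T\<close> will be the set of in- or out-neighbours of \<open>a\<close>.
    One of its \<open>m\<close> places is taken by \<open>x\<close>, which leaves
    \<open>m - 1\<close> for \<open>?K \<union> ?L\<close>.\<close>
  have KL: "?K = ?L" if "x \<in> Q" "insert x (?K \<union> ?L) \<subseteq> T" "card T = m" for x T
  proof -
    have fT: "finite T" using that(3) m3 by (metis card.infinite not_numeral_le_zero)
    have "x \<notin> ?K \<union> ?L" using that(1) X(1) Y(1) by auto
    then have "Suc (card (?K \<union> ?L)) \<le> m"
      using card_mono[OF fT that(2)] that(3) fX by simp
    then have "card (?K \<union> ?L) \<le> m - 1" by simp
    then have "?K = ?K \<union> ?L" using cK fX by (intro card_seteq) simp_all
    moreover have "?L = ?K \<union> ?L"
      using cK fX \<open>card (?K \<union> ?L) \<le> m - 1\<close> by (intro card_seteq) simp_all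
    ultimately show ?thesis by simp
  qed
  from abc(1) obtain x where x: "x \<in> Q" "(x, a) \<in> A \<or> (a, x) \<in> A" by (auto simp: ends_def)
  have "?K = ?L"
    using x(2)
  proof
    assume "(x, a) \<in> A"
    then have "insert x (?K \<union> ?L) \<subseteq> A\<inverse> `` {a}" using arcs arcs' X(2) Y(2) by auto
    then show ?thesis using KL x(1) low(2) by metis
  next
    assume "(a, x) \<in> A"
    then have "insert x (?K \<union> ?L) \<subseteq> A `` {a}" using arcs arcs' X(2) Y(2) by auto
    then show ?thesis using KL x(1) low(1) by metis
  qed
  have "c \<notin> X" using third[OF X(5,2)] abc ne by auto
  have "m + 1 \<le> outdeg A p" if p: "p \<in> ?K" for p
  proof -
    have "p \<in> ?L" using p \<open>?K = ?L\<close> by simp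
    then have "(p, c) \<in> A" using arcs'[of p c] Y(3) by auto
    moreover have "(p, q) \<in> A" if "q \<in> X - {p}" for q using arcs[of p q] p that by auto
    ultimately have "insert c (X - {p}) \<subseteq> A `` {p}" by auto
    then have "card (insert c (X - {p})) \<le> outdeg A p"
      unfolding outdeg_def using fin by (intro card_mono) (auto simp: finite_Image)
    then show ?thesis using \<open>c \<notin> X\<close> fX p X(4) by simp
  qed
  then have "(\<Sum>p\<in>?K. 1) \<le> m - 2" using X(1) by (intro excess_le) auto
  then show False using cK(1) m3 by simp
qed

text \<open>Every vertex \<open>x\<close> of \<open>Q\<close> has degree \<open>m\<close> both ways,
  hence one out-neighbour \<open>e x\<close> and one in-neighbour \<open>e' x\<close> outside
  \<open>Q\<close>, both among \<open>a\<close> and \<open>b\<close>. Once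
  \<open>V = X \<union> Q\<close> and \<open>e' x = e x\<close> are known, the fibres of
  \<open>e\<close> are the parts \<open>B\<close> and \<open>C\<close>, and \<open>S\<close> is
  \<open>X\<close> without \<open>a\<close> and \<open>b\<close>.\<close>

lemma two_ends_dirac:
  assumes Q: "clique Q" and ab: "a \<in> ends Q" "b \<in> ends Q" "a \<noteq> b"
  shows "dirac_digraph m A \<and> card A = m * card V + m - 2"
proof -
  interpret conv: sparse_critical_digraph "A\<inverse>" m by (rule sparse_critical_digraph_converse)
  have Q': "conv.clique Q" using Q by (simp add: clique_converse)
  obtain X where X: "X \<subseteq> V - Q" "a \<in> X" "b \<in> X" "card X = m + 1"
    "Restr A X = complete_on X - {(a, b), (b, a)}"
    "card A = m * card V + m - 2"
    "card (A \<inter> X \<times> (- X)) = m" "card (A \<inter> (- X) \<times> X) = m"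
    "\<forall>v\<in>V - X. outdeg A v = m \<and> outdeg (A\<inverse>) v = m"
    using digon_clique[OF Q ab] .
  have ends: "w \<in> {a, b}" if "w \<in> ends Q" for w using ends_le_two[OF Q ab(1,2) that ab(3)] by auto
  have low: "outdeg A x = m" "outdeg (A\<inverse>) x = m" if "x \<in> Q" for x
    using X(9) X(1) clique_subset[OF Q] that by auto
  have "\<exists>w. A `` {x} - Q = {w}" "\<exists>w. A\<inverse> `` {x} - Q = {w}" if "x \<in> Q" for x
    using ex_out_end[OF Q that low(1)[OF that]] conv.ex_out_end[OF Q' that low(2)[OF that]] by auto
  then obtain e e' where e: "\<And>x. x \<in> Q \<Longrightarrow> A `` {x} - Q = {e x}" and e': "\<And>x. x \<in> Q \<Longrightarrow> A\<inverse> `` {x} - Q = {e' x}"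
    by metis
  have eA: "(x, e x) \<in> A" "e x \<notin> Q" "(e' x, x) \<in> A" "e' x \<notin> Q" if "x \<in> Q" for x
    using e[OF that] e'[OF that] by auto
  have e_eq: "y = e x" if "(x, y) \<in> A" "x \<in> Q" "y \<notin> Q" for x y using e[OF that(2)] that by auto
  have e'_eq: "y = e' x" if "(y, x) \<in> A" "x \<in> Q" "y \<notin> Q" for x y using e'[OF that(2)] that by auto
  have e_ab: "e x \<in> {a, b}" "e' x \<in> {a, b}" if "x \<in> Q" for x
    using eA[OF that] that low[OF that] by (intro ends; auto simp: ends_def)+
  \<comment> \<open>The arcs from \<open>Q\<close> account for all \<open>m\<close> arcs entering
    \<open>X\<close>, so no arc would leave the set of remaining vertices, against
    \<open>cut\<close>.\<close>
  have VX: "V = X \<union> Q"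
  proof (rule ccontr)
    let ?Z = "V - X - Q"
    assume "V \<noteq> X \<union> Q"
    then have "?Z \<noteq> {}" using X(1) clique_subset[OF Q] by auto
    have "(\<lambda>x. (x, e x)) ` Q = A \<inter> (- X) \<times> X"
    proof (rule card_seteq)
      show "(\<lambda>x. (x, e x)) ` Q \<subseteq> A \<inter> (- X) \<times> X" using eA e_ab X(1,2,3) by fastforce
      have "card ((\<lambda>x. (x, e x)) ` Q) = card Q" by (intro card_image) (auto simp: inj_on_def)
      then show "card (A \<inter> (- X) \<times> X) \<le> card ((\<lambda>x. (x, e x)) ` Q)"
        using X(8) Q by (simp add: clique_def)
    qed (use fin in auto)
    then have "(u, v) \<notin> A" if "u \<in> ?Z" "v \<in> X" for u v using that by blast
    moreover have "(u, v) \<notin> A" if "u \<in> ?Z" "v \<in> Q" for u v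
    proof
      assume "(u, v) \<in> A"
      then have "u = e' v" using e'_eq that by auto
      then show False using e_ab(2)[OF that(2)] that(1) X(2,3) by auto
    qed
    ultimately have "A \<inter> ?Z \<times> (- ?Z) = {}" by (auto intro: FieldI2)
    moreover have "m \<le> card (A \<inter> ?Z \<times> (- ?Z))" using \<open>?Z \<noteq> {}\<close> X(2) \<open>X \<subseteq> V - Q\<close> by (intro cut) auto
    ultimately show False using m3 by simp
  qed
  have arcs: "(u, v) \<in> A" if "u \<in> X" "v \<in> X" "u \<noteq> v" "(u, v) \<notin> {(a, b), (b, a)}" for u v
    using that X(5) by (auto simp: complete_on_def)
  have noarc: "(u, v) \<notin> A" if "u \<in> {a, b}" "v \<in> {a, b}" for u v
    using that X(2,3,5) by (auto simp: complete_on_def)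
  have "\<not> V \<subseteq> - Q" using clique_nonempty[OF Q] clique_subset[OF Q] by auto
  from colourable_Restr[OF this]
  obtain \<phi> where \<phi>: "\<And>v. \<phi> v < m" "acyclic (monochr \<phi> (Restr A (- Q)))"
    unfolding colourable_def by auto
  obtain c where c: "\<And>x. x \<in> Q \<Longrightarrow> \<not> acyclic (Restr A (insert x {v. v \<notin> Q \<and> \<phi> v = c}))"
    using clique_colouring[OF Q \<phi>] by auto
  have \<phi>ab: "\<phi> a = c" "\<phi> b = c" using ends_colour[OF Q \<phi>(2) c] ab by auto
  \<comment> \<open>All other vertices of \<open>X\<close> are joined to \<open>a\<close> by a digon
    and so cannot have colour \<open>c\<close>.\<close>
  have cls: "v \<in> {a, b}" if v: "v \<in> V" "v \<notin> Q" "\<phi> v = c" for v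
  proof (rule ccontr)
    assume ne: "v \<notin> {a, b}"
    have "v \<in> X" using v VX by auto
    then have "(a, v) \<in> A" "(v, a) \<in> A" using arcs[of a v] arcs[of v a] X(2) ne by auto
    moreover have "a \<notin> Q" using X(1,2) by auto
    ultimately have "(a, v) \<in> monochr \<phi> (Restr A (- Q))" "(v, a) \<in> monochr \<phi> (Restr A (- Q))"
      using v \<phi>ab by (auto simp: monochr_def)
    then show False using acyclic_no_digon[OF \<phi>(2)] by simp
  qed
  \<comment> \<open>Otherwise \<open>x\<close> together with class \<open>c\<close> would span at
    most the path from \<open>e' x\<close> over \<open>x\<close> to \<open>e x\<close>, and
    \<open>c\<close> would be available to \<open>x\<close>.\<close>
  have e'e: "e' x = e x" if x: "x \<in> Q" for x
  proof (rule ccontr)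
    assume ne: "e' x \<noteq> e x"
    have "Restr A (insert x {v. v \<notin> Q \<and> \<phi> v = c}) \<subseteq> {(e' x, x), (x, e x)}"
    proof
      fix z assume "z \<in> Restr A (insert x {v. v \<notin> Q \<and> \<phi> v = c})"
      then obtain u v where z: "z = (u, v)" "(u, v) \<in> A" "u = x \<or> u \<notin> Q \<and> \<phi> u = c" "v = x \<or> v \<notin> Q \<and> \<phi> v = c"
        by auto
      have uv: "u \<in> V" "v \<in> V" using z(2) by (auto intro: FieldI1 FieldI2)
      consider "u = x" "v \<notin> Q" | "v = x" "u \<notin> Q" | "u \<in> {a, b}" "v \<in> {a, b}"
        using z(2-4) cls uv loopfree by metis
      then show "z \<in> {(e' x, x), (x, e x)}"
        using e_eq[OF z(2)] e'_eq[OF z(2)] x z(1,2) noarc by cases auto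
    qed
    moreover have "wf {(e' x, x), (x, e x)}"
      by (rule wf_subset[of "measure (\<lambda>v. if v = e x then 2 else if v = x then 1 else 0)"])
        (use ne eA(2,4)[OF x] x in auto)
    ultimately have "wf (Restr A (insert x {v. v \<notin> Q \<and> \<phi> v = c}))"
      by (rule wf_subset[rotated])
    then show False using c[OF x] wf_acyclic by auto
  qed
  let ?S = "X - {a, b}" and ?B = "{x \<in> Q. e x = a}" and ?C = "{x \<in> Q. e x = b}"
  have abQ: "a \<notin> Q" "b \<notin> Q" using X(1,2,3) by auto
  have BC: "?B \<union> ?C = Q" using e_ab(1) by auto
  have "A = Restr A X \<union> complete_on Q \<union> {(x, e x) | x. x \<in> Q} \<union> {(e x, x) | x. x \<in> Q}" (is "A = ?R")
  proof (rule set_eqI, clarify)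
    fix u v
    have "(u, v) \<in> ?R" if "(u, v) \<in> A"
    proof -
      have "u \<in> X \<union> Q" "v \<in> X \<union> Q" using that VX by (auto intro: FieldI1 FieldI2)
      then consider "u \<in> X" "v \<in> X" | "u \<in> Q" "v \<in> Q" | "u \<in> Q" "v \<notin> Q" | "u \<notin> Q" "v \<in> Q" by auto
      then show ?thesis
      proof cases
        case 2 then show ?thesis using that loopfree by (auto simp: complete_on_def)
      next
        case 3 then show ?thesis using e_eq[OF that] by auto
      next
        case 4 then show ?thesis using e'_eq[OF that] e'e by auto
      qed (use that in auto)
    qed
    moreover have "(u, v) \<in> A" if "(u, v) \<in> ?R"
      using that eA e'e clique_arc[OF Q] by (auto simp: complete_on_def)
    ultimately show "(u, v) \<in> A \<longleftrightarrow> (u, v) \<in> ?R" by blast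
  qed
  also have "\<dots> = complete_on (insert a ?S) \<union> complete_on (insert b ?S) \<union> complete_on (?B \<union> ?C) \<union>
       complete_on (insert a ?B) \<union> complete_on (insert b ?C)"
  proof -
    have 1: "Restr A X = complete_on (insert a ?S) \<union> complete_on (insert b ?S)"
      unfolding X(5) using X(2,3) ab(3) by (auto simp: complete_on_def)
    have 2: "{(x, e x) | x. x \<in> Q} = ?B \<times> {a} \<union> ?C \<times> {b}" using e_ab(1) by force
    have 3: "{(e x, x) | x. x \<in> Q} = {a} \<times> ?B \<union> {b} \<times> ?C" using e_ab(1) by force
    have "complete_on ?B \<subseteq> complete_on Q" "complete_on ?C \<subseteq> complete_on Q"
      by (auto intro!: complete_on_mono)
    moreover have "complete_on (insert a ?B) = complete_on ?B \<union> {a} \<times> ?B \<union> ?B \<times> {a}"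
      "complete_on (insert b ?C) = complete_on ?C \<union> {b} \<times> ?C \<union> ?C \<times> {b}"
      using abQ by (auto intro!: complete_on_insert)
    ultimately show ?thesis unfolding 1 2 3 BC by (simp only: Un_absorb2 ac_simps) blast
  qed
  finally have A_eq: "A = complete_on (insert a ?S) \<union> complete_on (insert b ?S) \<union> complete_on (?B \<union> ?C) \<union>
       complete_on (insert a ?B) \<union> complete_on (insert b ?C)" .
  have ex_e: "\<exists>x\<in>Q. e x = w" if "w \<in> ends Q" for w
  proof -
    from that obtain x where x: "x \<in> Q" "w \<notin> Q" "(x, w) \<in> A \<or> (w, x) \<in> A" by (auto simp: ends_def)
    then have "w = e x" using e_eq[of x w] e'_eq[of w x] e'e by auto
    then show ?thesis using x(1) by auto
  qed
  have "finite X" using X(1) finV by (meson finite_Diff finite_subset)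
  have "dirac_digraph m A"
    unfolding dirac_digraph_def
  proof (intro exI conjI)
    show "A = complete_on (insert a ?S) \<union> complete_on (insert b ?S) \<union> complete_on (?B \<union> ?C) \<union>
       complete_on (insert a ?B) \<union> complete_on (insert b ?C)" by (rule A_eq)
    show "card ?S = m - 1" using X(2-4) ab(3) \<open>finite X\<close> by (simp add: card_Diff_subset)
    show "card (?B \<union> ?C) = m" using BC Q by (simp add: clique_def)
    show "?B \<noteq> {}" "?C \<noteq> {}" using ex_e[OF ab(1)] ex_e[OF ab(2)] by auto
    show "?S \<inter> (?B \<union> ?C) = {}" using X(1) by auto
    show "{a, b} \<inter> (?S \<union> ?B \<union> ?C) = {}" using abQ by auto
  qed (use ab(3) in auto)
  then show ?thesis using X(6) by simp
qed

text \<open>Contraction loses one vertex, so \<open>Restr_le\<close> for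
  \<open>insert y (Field F)\<close> leaves at most \<open>m * card (Field F) + m - 2\<close> arcs in
  \<open>F\<close>. This rules out the last alternative of \<open>IH\<close> and makes the middle
  one tight.\<close>

lemma contraction_cases:
  assumes F: "critical_digraph F m" "insert y (Field F) \<subseteq> V - {v}" "y \<notin> Field F" "v \<in> V"
    "card F \<le> card (Restr A (insert y (Field F)))"
  shows "F = complete_on (Field F) \<and> card (Field F) = m + 1 \<or>
    (\<exists>P Q. P \<inter> Q = {} \<and> card P = m \<and> card Q = m \<and> complete_on P \<subseteq> F \<and> complete_on Q \<subseteq> F) \<and>
      m * card (insert y (Field F)) \<le> card (Restr A (insert y (Field F))) + 2"
proof -
  interpret F: critical_digraph F m by (rule F(1))
  have W: "insert y (Field F) \<subseteq> V" "insert y (Field F) \<noteq> {}" "insert y (Field F) \<noteq> V"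
    using F(2,4) by auto
  have cW: "card (insert y (Field F)) = Suc (card (Field F))" using F(3) by simp
  have "card (insert y (Field F)) < card V" using W by (intro psubset_card_mono) auto
  then have "card (Field F) < card V" using cW by simp
  moreover have "\<not> m * card (Field F) + m - 1 \<le> card F"
    using Restr_le(1)[OF W] F(5) cW m3 by simp
  moreover have "m * card (insert y (Field F)) \<le> card (Restr A (insert y (Field F))) + 2"
    if "m * card (Field F) + m - 2 \<le> card F"
    using that F(5) cW by simp
  ultimately show ?thesis using IH[OF F.fin F.loopfree F.crit] by blast
qed

text \<open>If the out-neighbours of a vertex of out-degree \<open>m\<close> are not a clique,
  contract two of them into \<open>x\<close>. The result has a clique avoiding \<open>x\<close>: the
  complete digraph minus \<open>x\<close>, or one of two disjoint cliques. Away from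
  \<open>x\<close> its arcs are arcs of \<open>A\<close>.\<close>

lemma ex_clique: "\<exists>Q. clique Q"
proof -
  have "A \<noteq> {}" using crit colourable_empty[OF m_pos] critical_not_colourable by metis
  then obtain a where a: "a \<in> V" by (auto simp: Field_def)
  have "\<exists>v\<in>V. outdeg A v = m"
  proof (rule ccontr)
    assume none: "\<not> ?thesis"
    have "m + 1 \<le> outdeg A u" if "u \<in> V" for u
    proof -
      have "outdeg A u \<noteq> m" using none that by auto
      then show ?thesis using outdeg_ge[OF that] by simp
    qed
    then have "(\<Sum>u\<in>V. 1) \<le> m - 2" by (intro excess_le) auto
    moreover have "outdeg A a \<le> card V"
      unfolding outdeg_def by (intro card_mono) (auto intro: FieldI2)
    ultimately show False using outdeg_ge[OF a] m3 by simp
  qed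
  then obtain v where v: "v \<in> V" "outdeg A v = m" by auto
  show ?thesis
  proof (cases "complete_on (A `` {v}) \<subseteq> A")
    case True
    then show ?thesis using v(2) by (auto simp: clique_def outdeg_def)
  next
    case False
    then obtain x y where xy: "(v, x) \<in> A" "(v, y) \<in> A" "x \<noteq> y" "(x, y) \<notin> A"
      by (auto simp: complete_on_def)
    obtain F where F: "critical_digraph F m" "x \<in> Field F" "insert y (Field F) \<subseteq> V - {v}" "y \<notin> Field F"
      "card F \<le> card (Restr A (insert y (Field F)))"
      "\<And>p q. (p, q) \<in> F \<Longrightarrow> p \<noteq> x \<Longrightarrow> q \<noteq> x \<Longrightarrow> (p, q) \<in> A"
      using contraction[OF v(2) xy(1,2,3)] xy(4) by metis
    have cl: "clique P" if "card P = m" "complete_on P \<subseteq> F" "x \<notin> P" for P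
      unfolding clique_def using that F(6) by (fastforce simp: complete_on_def)
    consider "F = complete_on (Field F)" "card (Field F) = m + 1" |
      P Q where "P \<inter> Q = {}" "card P = m" "card Q = m" "complete_on P \<subseteq> F" "complete_on Q \<subseteq> F"
      using contraction_cases[OF F(1,3,4) v(1) F(5)] by blast
    then show ?thesis
    proof cases
      case 1
      have "complete_on (Field F - {x}) \<subseteq> F" by (subst 1(1)) (rule complete_on_mono, auto)
      moreover have "card (Field F - {x}) = m" using 1(2) F(2) by simp
      ultimately show ?thesis using cl by blast
    next
      case 2
      then have "x \<notin> P \<or> x \<notin> Q" by auto
      then show ?thesis using cl[OF 2(2,4)] cl[OF 2(3,5)] by metis
    qed
  qed
qed

text \<open>
  The arcs from \<open>Q \<inter> W - {u}\<close> to \<open>Q - W\<close> already exhaust the total excess \<open>m - 2\<close>.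
\<close>

lemma low_if_excess_split:
  assumes Q: "clique Q" and W: "u \<in> W" "u \<in> Q" "p0 \<in> Q \<inter> W - {u}" "q \<in> Q - W"
    and deg: "\<And>p. p \<in> Q \<inter> W - {u} \<Longrightarrow> m \<le> card (A `` {p} \<inter> W)"
  shows "outdeg A u = m"
proof (rule ccontr)
  let ?T = "Q \<inter> W - {u}" and ?U = "Q - W"
  assume "outdeg A u \<noteq> m"
  then have u: "m + 1 \<le> outdeg A u" using outdeg_ge[of u] clique_subset[OF Q] W(2) by fastforce
  have fQ: "finite Q" by (rule finite_clique[OF Q])
  have "m + (if p = u then 1 else card ?U) \<le> outdeg A p" if p: "p \<in> insert u ?T" for p
  proof (cases "p = u")
    case False
    then have p: "p \<in> ?T" using p by auto
    have "A `` {p} = A `` {p} \<inter> W \<union> (A `` {p} - W)" by auto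
    then have "outdeg A p = card (A `` {p} \<inter> W) + card (A `` {p} - W)"
      unfolding outdeg_def using fin by (metis card_Int_Diff finite_Image)
    moreover have "card ?U \<le> card (A `` {p} - W)"
      using clique_arc[OF Q] p fin by (intro card_mono) (auto simp: finite_Image)
    ultimately show ?thesis using deg[OF p] False by simp
  qed (use u in simp)
  then have "(\<Sum>p\<in>insert u ?T. if p = u then 1 else card ?U) \<le> m - 2"
    using clique_subset[OF Q] W(2) by (intro excess_le) auto
  moreover have "(\<Sum>p\<in>insert u ?T. if p = u then 1 else card ?U) = 1 + (\<Sum>p\<in>?T. card ?U)"
    using fQ by (subst sum.insert) (auto intro!: sum.cong)
  ultimately have le: "1 + card ?T * card ?U \<le> m - 2" by simp
  \<comment> \<open>Now \<open>m = 1 + card ?T + card ?U\<close> with both sizes positive, so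
    \<open>card ?T * card ?U \<ge> m - 2\<close>; the excess of \<open>u\<close> adds one
    more.\<close>
  have "Q = insert u (?T \<union> ?U)" using W by auto
  then have "card Q = Suc (card (?T \<union> ?U))"
    using fQ W(1) by (metis card_insert_disjoint finite_Un finite_Diff finite_Int DiffE UnE insertI1)
  also have "card (?T \<union> ?U) = card ?T + card ?U" using fQ by (intro card_Un_disjoint) auto
  finally have "m = Suc (card ?T + card ?U)" using Q by (simp add: clique_def)
  moreover obtain s where "card ?T = Suc s"
    using W(3) fQ by (metis card_Suc_Diff1 finite_Diff finite_Int)
  moreover obtain t where "card ?U = Suc t" using W(4) fQ by (metis card_Suc_Diff1 finite_Diff)
  ultimately show False using le by simp
qed

text \<open>\<open>Y\<close> and the vertices of \<open>X\<close> with in-degree \<open>m\<close>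
  are out-neighbours of \<open>z\<close>. The excess of \<open>z\<close> and those of the vertices
  of \<open>X\<close> with out-degree above \<open>m\<close> share the budget \<open>m - 2\<close>.
  Mixing the two directions lets the bound be added to its converse.\<close>

lemma degree_count:
  assumes "z \<in> V" "z \<notin> X" "X \<subseteq> V" "Y \<inter> X = {}" "Y \<subseteq> A `` {z}"
    and "\<And>x. x \<in> X \<Longrightarrow> outdeg (A\<inverse>) x = m \<Longrightarrow> (z, x) \<in> A"
  shows "card Y + card {x \<in> X. outdeg (A\<inverse>) x = m} + card {x \<in> X. outdeg A x \<noteq> m} \<le> 2 * m - 2"
proof -
  let ?L = "{x \<in> X. outdeg (A\<inverse>) x = m}" and ?H = "{x \<in> X. outdeg A x \<noteq> m}"
  have fX: "finite X" using assms(3) finV by (rule finite_subset)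
  have fz: "finite (A `` {z})" using fin by (rule finite_Image)
  have "?L \<subseteq> A `` {z}" using assms(6) by auto
  then have "card (Y \<union> ?L) \<le> card (A `` {z})" using assms(5) by (intro card_mono[OF fz]) simp
  moreover have "card (Y \<union> ?L) = card Y + card ?L"
    using fX finite_subset[OF assms(5) fz] assms(4) by (intro card_Un_disjoint) auto
  ultimately have z: "card Y + card ?L \<le> outdeg A z" by (simp add: outdeg_def)
  have "m + (if x = z then outdeg A z - m else 1) \<le> outdeg A x" if "x \<in> insert z ?H" for x
    using that outdeg_ge[OF assms(1)] outdeg_ge[of x] assms(3) by (cases "x = z") fastforce+
  then have "(\<Sum>x\<in>insert z ?H. if x = z then outdeg A z - m else 1) \<le> m - 2"
    using assms(1,3) by (intro excess_le) auto
  moreover have "(\<Sum>x\<in>?H. if x = z then outdeg A z - m else 1) = (\<Sum>x\<in>?H. 1)"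
    using assms(2) by (intro sum.cong) auto
  then have "(\<Sum>x\<in>insert z ?H. if x = z then outdeg A z - m else 1) = (outdeg A z - m) + card ?H"
    using fX assms(2) by simp
  ultimately show ?thesis using z m3 by simp
qed

text \<open>
  Vertices of \<open>X\<close> not joined to \<open>z\<close> have positive excess, so what \<open>z\<close> loses in degree they gain.
\<close>

lemma degree_count_both:
  assumes "z \<in> V" "z \<notin> X" "X \<subseteq> V" "Y \<inter> X = {}" "\<And>y. y \<in> Y \<Longrightarrow> (z, y) \<in> A \<and> (y, z) \<in> A"
    and "\<And>x. x \<in> X \<Longrightarrow> outdeg (A\<inverse>) x = m \<Longrightarrow> (z, x) \<in> A"
    and "\<And>x. x \<in> X \<Longrightarrow> outdeg A x = m \<Longrightarrow> (x, z) \<in> A"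
  shows "card Y + card X \<le> 2 * m - 2"
proof -
  interpret conv: sparse_critical_digraph "A\<inverse>" m by (rule sparse_critical_digraph_converse)
  have fX: "finite X" using assms(3) finV by (rule finite_subset)
  have split: "card X = card {x \<in> X. P x} + card {x \<in> X. \<not> P x}" for P
    using fX by (subst card_Un_disjoint[symmetric]) (auto intro!: arg_cong[of _ _ card])
  have "card Y + card {x \<in> X. outdeg (A\<inverse>) x = m} + card {x \<in> X. outdeg A x \<noteq> m} \<le> 2 * m - 2"
    using assms by (intro degree_count) auto
  moreover have "card Y + card {x \<in> X. outdeg ((A\<inverse>)\<inverse>) x = m} + card {x \<in> X. outdeg (A\<inverse>) x \<noteq> m} \<le> 2 * m - 2"
    using assms by (intro conv.degree_count) auto
  ultimately show ?thesis
    using split[of "\<lambda>x. outdeg A x = m"] split[of "\<lambda>x. outdeg (A\<inverse>) x = m"] by simp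
qed

section \<open>Cliques with a single end\<close>

lemma single_end:
  assumes nd: "\<not> (dirac_digraph m A \<and> card A = m * card V + m - 2)" and Q: "clique Q"
  shows "\<exists>w. ends Q = {w}"
proof -
  obtain x where x: "x \<in> Q" "outdeg A x = m" using ex_low[OF Q, of undefined] by auto
  obtain w where "A `` {x} - Q = {w}" using ex_out_end[OF Q x] by auto
  then have "w \<in> ends Q" using x by (auto simp: ends_def)
  moreover have "w' = w" if "w' \<in> ends Q" for w'
    using two_ends_dirac[OF Q that \<open>w \<in> ends Q\<close>] nd by auto
  ultimately show ?thesis by auto
qed

lemma end_arcs:
  assumes Q: "clique Q" and w: "ends Q = {w}" and x: "x \<in> Q"
  shows "outdeg A x = m \<Longrightarrow> A `` {x} - Q = {w}" "outdeg (A\<inverse>) x = m \<Longrightarrow> A\<inverse> `` {x} - Q = {w}"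
proof -
  interpret conv: sparse_critical_digraph "A\<inverse>" m by (rule sparse_critical_digraph_converse)
  have Q': "conv.clique Q" using Q by (simp add: clique_converse)
  show "A `` {x} - Q = {w}" if low: "outdeg A x = m"
  proof -
    obtain w' where w': "A `` {x} - Q = {w'}" using ex_out_end[OF Q x low] by auto
    then have "w' \<in> ends Q" using x low by (auto simp: ends_def)
    then show ?thesis using w w' by simp
  qed
  show "A\<inverse> `` {x} - Q = {w}" if low: "outdeg (A\<inverse>) x = m"
  proof -
    obtain w' where w': "A\<inverse> `` {x} - Q = {w'}" using conv.ex_out_end[OF Q' x low] by auto
    then have "w' \<in> ends Q" using x low by (auto simp: ends_def)
    then show ?thesis using w w' by simp
  qed
qed

lemma dirac_if_sparse: "dirac_digraph m A \<and> card A = m * card V + m - 2"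
proof (rule ccontr)
  assume nd: "\<not> ?thesis"
  interpret conv: sparse_critical_digraph "A\<inverse>" m by (rule sparse_critical_digraph_converse)
  obtain Q where Q: "clique Q" using ex_clique by auto
  then have Q': "conv.clique Q" by (simp add: clique_converse)
  obtain w where w: "ends Q = {w}" using single_end[OF nd Q] by auto
  have wQ: "w \<notin> Q" "w \<in> V" using ends_subset[OF Q] w by auto
  have fQ: "finite Q" by (rule finite_clique[OF Q])
  have "\<exists>u\<in>Q. (u, w) \<notin> A \<or> (w, u) \<notin> A"
  proof (rule ccontr)
    assume "\<not> ?thesis"
    then have "complete_on (insert w Q) \<subseteq> A" using clique_arc[OF Q] by (auto simp: complete_on_def)
    moreover have "card (insert w Q) = m + 1" using wQ fQ Q by (simp add: clique_def)
    ultimately show False using no_clique by auto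
  qed
  then obtain u where u: "u \<in> Q" "(u, w) \<notin> A \<or> (w, u) \<notin> A" by auto
  \<comment> \<open>A vertex of degree \<open>m\<close> in both directions would be joined to the
    only end \<open>w\<close> by a digon.\<close>
  have low_digon: "\<not> (outdeg A u = m \<and> outdeg (A\<inverse>) u = m)"
    using end_arcs[OF Q w u(1)] u(2) by auto
  \<comment> \<open>\<open>q\<close> is the vertex deleted in the contraction: having out-degree
    \<open>m\<close>, it sends arcs to \<open>w\<close> as well as to \<open>u\<close>.\<close>
  obtain q where q: "q \<in> Q" "q \<noteq> u" "outdeg A q = m" using ex_low[OF Q] by auto
  have qw: "(q, w) \<in> A" "(q, u) \<in> A"
    using end_arcs(1)[OF Q w q(1,3)] clique_arc[OF Q q(1) u(1) q(2)] by auto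
  have "u \<noteq> w" "q \<in> V" using u wQ q clique_subset[OF Q] by auto
  obtain F where F: "critical_digraph F m" "u \<in> Field F" "insert w (Field F) \<subseteq> V - {q}" "w \<notin> Field F"
      "card F \<le> card (Restr A (insert w (Field F)))"
      "\<And>p r. (p, r) \<in> F \<Longrightarrow> p \<noteq> u \<Longrightarrow> r \<noteq> u \<Longrightarrow> (p, r) \<in> A"
      "\<And>r. (u, r) \<in> F \<Longrightarrow> (u, r) \<in> A \<or> (w, r) \<in> A"
      "\<And>p. (p, u) \<in> F \<Longrightarrow> (p, u) \<in> A \<or> (p, w) \<in> A"
    using contraction[OF q(3) qw(2,1) \<open>u \<noteq> w\<close> u(2)] by blast
  interpret F: critical_digraph F m by (rule F(1))
  interpret Fc: critical_digraph "F\<inverse>" m by (rule F.critical_digraph_converse)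
  define W where "W = insert w (Field F)"
  have W: "W \<subseteq> V" "W \<noteq> {}" "W \<noteq> V" "u \<in> W" "q \<notin> W"
    using F(2,3) \<open>q \<in> V\<close> by (auto simp: W_def)
  \<comment> \<open>Degrees of at least \<open>m\<close> in the critical \<open>F\<close> are pulled
    back to \<open>A\<close>, for both directions.\<close>
  have degs: "m \<le> card (A `` {p} \<inter> W)" "m \<le> card (A\<inverse> `` {p} \<inter> W)" if p: "p \<in> Field F - {u}" for p
  proof -
    have Weq: "insert w (insert u (Field F)) = W" "insert w (insert u (Field (F\<inverse>))) = W"
      using F(2) by (auto simp: W_def)
    have "outdeg F p \<le> card (A `` {p} \<inter> insert w (insert u (Field F)))"
      using p by (intro outdeg_le_pullback fin F(4,6,8)) auto
    then show "m \<le> card (A `` {p} \<inter> W)" using F.outdeg_ge[of p] p unfolding Weq by simp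
    have "outdeg (F\<inverse>) p \<le> card (A\<inverse> `` {p} \<inter> insert w (insert u (Field (F\<inverse>))))"
      using p F(4,6,7) by (intro outdeg_le_pullback conv.fin) auto
    then show "m \<le> card (A\<inverse> `` {p} \<inter> W)" using Fc.outdeg_ge[of p] p unfolding Weq by simp
  qed
  \<comment> \<open>A further vertex of \<open>Q\<close> in \<open>W\<close> would allow
    \<open>low_if_excess_split\<close> in both directions, since \<open>q\<close> lies outside
    \<open>W\<close>; this contradicts \<open>low_digon\<close>.\<close>
  have QW: "Q \<inter> W = {u}"
  proof (rule ccontr)
    assume "Q \<inter> W \<noteq> {u}"
    then obtain p0 where p0: "p0 \<in> Q \<inter> W - {u}" using u(1) W(4) by auto
    have *: "Q \<inter> W - {u} \<subseteq> Field F - {u}" using wQ by (auto simp: W_def)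
    have "q \<in> Q - W" using q W(5) by simp
    have "outdeg A u = m"
      using low_if_excess_split[OF Q W(4) u(1) p0 \<open>q \<in> Q - W\<close> degs(1)] * by blast
    moreover have "outdeg (A\<inverse>) u = m"
      using conv.low_if_excess_split[OF Q' W(4) u(1) p0 \<open>q \<in> Q - W\<close> degs(2)] * by blast
    ultimately show False using low_digon by simp
  qed
  consider "F = complete_on (Field F)" "card (Field F) = m + 1" | "m * card W \<le> card (Restr A W) + 2"
    using contraction_cases[OF F(1,3,4) \<open>q \<in> V\<close> F(5)] unfolding W_def by auto
  then show False
  proof cases
    case 2
    note tight = Restr_tight[OF W(1-3) 2]
    \<comment> \<open>These are \<open>2 * (m - 1)\<close> arcs entering \<open>W\<close>, but
      tightness permits only \<open>m\<close>, which is smaller as \<open>m \<ge> 3\<close>.\<close>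
    have "(Q - {u}) \<times> {u, w} \<subseteq> A \<inter> (- W) \<times> W"
    proof (rule subrelI)
      fix x y assume "(x, y) \<in> (Q - {u}) \<times> {u, w}"
      then have x: "x \<in> Q" "x \<noteq> u" "y \<in> {u, w}" by auto
      have "x \<notin> W" using x QW by auto
      moreover have "outdeg A x = m" using tight(4) x \<open>x \<notin> W\<close> clique_subset[OF Q] by auto
      then have "(x, w) \<in> A" using end_arcs(1)[OF Q w x(1)] by auto
      moreover have "(x, u) \<in> A" using clique_arc[OF Q] x u(1) by auto
      moreover have "w \<in> W" by (simp add: W_def)
      ultimately show "(x, y) \<in> A \<inter> (- W) \<times> W" using x(3) W(4) by auto
    qed
    then have "card ((Q - {u}) \<times> {u, w}) \<le> m"
      unfolding tight(3)[symmetric] using fin by (intro card_mono) auto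
    moreover have "card ((Q - {u}) \<times> {u, w}) = (m - 1) * 2"
      using u(1) fQ Q \<open>u \<noteq> w\<close> by (simp add: card_cartesian_product clique_def)
    ultimately show False using m3 by simp
  next
    case 1
    define P where "P = Field F - {u}"
    have Farc: "(p, r) \<in> F" if "p \<in> Field F" "r \<in> Field F" "p \<noteq> r" for p r
    proof -
      have "(p, r) \<in> complete_on (Field F)" using that by (simp add: complete_on_def)
      then show ?thesis by (simp only: 1(1)[symmetric])
    qed
    have "complete_on P \<subseteq> A"
      using F(6) Farc by (auto simp: complete_on_def P_def)
    moreover have "card P = m" using 1(2) F(2) by (simp add: P_def)
    ultimately have P: "clique P" by (simp add: clique_def)
    obtain z where z: "ends P = {z}" using single_end[OF nd P] by auto
    have QP: "Q \<inter> P = {}" using QW by (auto simp: P_def W_def)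
    obtain x where x: "x \<in> P" "outdeg A x = m" using ex_low[OF P, of undefined] by auto
    \<comment> \<open>An arc of \<open>F\<close> into the merged vertex \<open>u\<close> comes from
      an arc of \<open>A\<close> into \<open>u\<close> or \<open>w\<close>; this locates the end of
      \<open>P\<close>.\<close>
    have "(x, u) \<in> A \<or> (x, w) \<in> A" using F(8) Farc[of x u] x(1) F(2) by (auto simp: P_def)
    moreover have "u \<notin> P" "w \<notin> P" using F(4) by (auto simp: P_def)
    ultimately have "z = u \<or> z = w" using end_arcs(1)[OF P z x] by auto
    have zP: "(z, x) \<in> A" if "x \<in> P" "outdeg (A\<inverse>) x = m"
      for x using end_arcs(2)[OF P z that] by auto
    have Pz: "(x, z) \<in> A" if "x \<in> P" "outdeg A x = m" for x using end_arcs(1)[OF P z that] by auto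
    have wA: "(w, x) \<in> A" if "x \<in> Q" "outdeg (A\<inverse>) x = m"
      for x using end_arcs(2)[OF Q w that] by auto
    have Aw: "(x, w) \<in> A" if "x \<in> Q" "outdeg A x = m" for x using end_arcs(1)[OF Q w that] by auto
    \<comment> \<open>In both cases the count exceeds \<open>2 * m - 2\<close>: for \<open>u\<close>
      it is \<open>2 * m - 1\<close>, from \<open>Q - {u}\<close> and \<open>P\<close>; for
      \<open>w\<close> it is \<open>2 * m\<close>, from \<open>Q\<close> and
      \<open>P\<close>.\<close>
    from \<open>z = u \<or> z = w\<close> show False
    proof
      assume "z = u"
      have "card (Q - {u}) + card P \<le> 2 * m - 2"
        using \<open>u \<notin> P\<close> QP clique_subset[OF P] clique_subset[OF Q] u(1) clique_arc[OF Q] zP Pz \<open>z = u\<close>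
        by (intro degree_count_both[of u]) auto
      then show False using Q P u(1) fQ m3 by (simp add: clique_def)
    next
      assume "z = w"
      have "card ({} :: 'a set) + card (Q \<union> P) \<le> 2 * m - 2"
        using \<open>w \<notin> P\<close> wQ clique_subset[OF P] clique_subset[OF Q] zP Pz wA Aw \<open>z = w\<close>
        by (intro degree_count_both[of w]) auto
      then show False
        using Q P QP fQ finite_clique[OF P] m3 by (simp add: clique_def card_Un_disjoint)
    qed
  qed
qed

end

text \<open>Strong induction on the number of vertices. A critical relation containing the complete
  one on \<open>m + 1\<close> vertices equals it, by minimality; otherwise, if the bound fails, the
  sparse locale applies.\<close>

lemma sparse_critical_cases:
  fixes A :: "'a rel"
  assumes "finite A" "\<And>v. (v, v) \<notin> A" "critical m A" "3 \<le> m"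
  shows "A = complete_on (Field A) \<and> card (Field A) = m + 1 \<or>
    dirac_digraph m A \<and> card A = m * card (Field A) + m - 2 \<or>
    m * card (Field A) + m - 1 \<le> card A"
  using assms(1-3)
proof (induction "card (Field A)" arbitrary: A rule: less_induct)
  case less
  interpret critical_digraph A m using less.prems assms(4) by unfold_locales auto
  show ?case
  proof (cases "(\<exists>X. complete_on X \<subseteq> A \<and> card X = m + 1) \<or> m * card V + m - 1 \<le> card A")
    case True
    moreover have "A = complete_on (Field A) \<and> card (Field A) = m + 1"
      if X: "complete_on X \<subseteq> A" "card X = m + 1" for X
    proof -
      have "finite X" using X(2) by (intro card_ge_0_finite) simp
      then have "A = complete_on X"
        using not_colourable_complete_on[of X m] X crit unfolding critical_def by auto
      moreover have "Field (complete_on X) = X" using X(2) m_pos by (intro Field_complete_on) simp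
      ultimately show ?thesis using X(2) by simp
    qed
    ultimately show ?thesis by blast
  next
    case False
    interpret sparse_critical_digraph A m
    proof
      show "3 \<le> m" by (rule assms(4))
      show "card A \<le> m * card V + m - 2" using False assms(4) by auto
      show "card X \<noteq> m + 1" if "complete_on X \<subseteq> A" for X using False that by blast
      fix F :: "'a rel"
      assume F: "finite F" "\<And>v. (v, v) \<notin> F" "critical m F" "card (Field F) < card V"
      show "F = complete_on (Field F) \<and> card (Field F) = m + 1 \<or>
        (\<exists>P Q. P \<inter> Q = {} \<and> card P = m \<and> card Q = m \<and> complete_on P \<subseteq> F \<and> complete_on Q \<subseteq> F) \<and>
          m * card (Field F) + m - 2 \<le> card F \<or>
        m * card (Field F) + m - 1 \<le> card F"
        (is "?K \<or> ?C \<and> ?le \<or> ?ge")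
        using less.hyps[OF F(4,1-3)]
      proof (elim disjE conjE)
        assume "dirac_digraph m F" "card F = m * card (Field F) + m - 2"
        then have "?C \<and> ?le" using dirac_disjoint_cliques[OF _ assms(4)] by simp
        then show ?thesis by (intro disjI2 disjI1)
      next
        assume "F = complete_on (Field F)" "card (Field F) = m + 1"
        then show ?thesis by (intro disjI1 conjI)
      next
        assume ?ge then show ?thesis by (intro disjI2)
      qed
    qed
    show ?thesis using dirac_if_sparse by blast
  qed
qed

section \<open>Digraphs and their arc relations\<close>

lemma (in wf_digraph) acyclic_digraph_iff: "acyclic_digraph G \<longleftrightarrow> acyclic (arcs_ends G)"
proof
  assume "acyclic_digraph G"
  then have no: "\<not> cycle p" for p by (simp add: acyclic_digraph_def)
  show "acyclic (arcs_ends G)"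
    unfolding acyclic_def
  proof (intro allI notI)
    fix u assume "(u, u) \<in> (arcs_ends G)\<^sup>+"
    then obtain p where "awalk u p u" "p \<noteq> []" by (auto simp: reachable1_awalk)
    then have "closed_w p" by (auto simp: closed_w_def)
    then show False using closed_w_imp_cycle no by auto
  qed
next
  assume "acyclic (arcs_ends G)"
  then have "\<not> cycle p" for p
    unfolding cycle_def acyclic_def using reachable1_awalkI by auto
  then show "acyclic_digraph G" by (simp add: acyclic_digraph_def)
qed

lemma (in wf_digraph) wf_digraph_induce: "wf_digraph (G \<restriction> X)"
  by unfold_locales (auto simp: induce_subgraph_def)

lemma arcs_ends_induce: "arcs_ends (G \<restriction> X) = Restr (arcs_ends G) X"
  by (auto simp: arcs_ends_def arc_to_ends_def induce_subgraph_def)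

lemma (in wf_digraph) dicolouring_iff:
  "dicolouring G P \<longleftrightarrow> partition_on (verts G) P \<and> (\<forall>X\<in>P. acyclic (Restr (arcs_ends G) X))"
  by (simp add: dicolouring_def wf_digraph.acyclic_digraph_iff[OF wf_digraph_induce] arcs_ends_induce)

lemma (in wf_digraph) arcs_ends_in_verts: "(u, v) \<in> arcs_ends G \<Longrightarrow> u \<in> verts G \<and> v \<in> verts G"
  by (auto simp: arcs_ends_def arc_to_ends_def)

lemma (in wf_digraph) colourable_if_dicolouring:
  assumes "dicolouring G P" "finite P" "card P \<le> m" "0 < m"
  shows "colourable m (arcs_ends G)"
proof -
  let ?A = "arcs_ends G"
  have P: "\<Union>P = verts G" "\<And>X. X \<in> P \<Longrightarrow> acyclic (Restr ?A X)"
    using assms(1) unfolding dicolouring_iff by (auto simp: partition_on_def)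
  obtain f where f: "bij_betw f P {0..<card P}" using ex_bij_betw_finite_nat[OF assms(2)] by auto
  have "\<forall>v\<in>verts G. \<exists>X. X \<in> P \<and> v \<in> X" unfolding P(1)[symmetric] by blast
  then obtain g where g: "\<And>v. v \<in> verts G \<Longrightarrow> g v \<in> P \<and> v \<in> g v" by metis
  \<comment> \<open>Outside the digraph the colour \<open>0\<close> is a default, admissible because
    \<open>0 < m\<close>.\<close>
  define \<phi> where "\<phi> v = (if v \<in> verts G then f (g v) else 0)" for v
  have "acyclic (Restr ?A {v. \<phi> v = c})" for c
  proof (cases "Restr ?A {v. \<phi> v = c} = {}")
    case True
    show ?thesis unfolding True by (simp add: acyclic_def)
  next
    case False
    then obtain u where u: "u \<in> verts G" "\<phi> u = c" using arcs_ends_in_verts by auto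
    have "v \<in> g u" if "v \<in> verts G" "\<phi> v = c" for v
    proof -
      have "f (g v) = f (g u)" using that u by (simp add: \<phi>_def)
      then have "g v = g u" using f g u(1) that(1) by (auto simp: bij_betw_def dest: inj_onD)
      then show ?thesis using g[OF that(1)] by simp
    qed
    then have "Restr ?A {v. \<phi> v = c} \<subseteq> Restr ?A (g u)" using arcs_ends_in_verts by auto
    then show ?thesis using P(2) g[OF u(1)] by (auto intro: acyclic_subset)
  qed
  moreover have "\<phi> v < m" for v
  proof (cases "v \<in> verts G")
    case True
    then have "f (g v) \<in> {0..<card P}" using f g by (auto simp: bij_betw_def)
    then show ?thesis using True assms(3) by (simp add: \<phi>_def)
  qed (use assms(4) in \<open>simp add: \<phi>_def\<close>)
  ultimately show ?thesis unfolding colourable_def acyclic_monochr_iff by auto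
qed

lemma (in fin_digraph) ex_dicolouring_if_colourable:
  assumes "colourable m (arcs_ends G)"
  shows "\<exists>P. dicolouring G P \<and> finite P \<and> card P \<le> m"
proof -
  obtain \<phi> where \<phi>: "\<And>v. \<phi> v < m" "acyclic (monochr \<phi> (arcs_ends G))"
    using assms unfolding colourable_def by auto
  \<comment> \<open>Only colours in use are taken, so that all parts are nonempty.\<close>
  define P where "P = (\<lambda>c. {v \<in> verts G. \<phi> v = c}) ` \<phi> ` verts G"
  have "partition_on (verts G) P"
    unfolding partition_on_def disjoint_def P_def by auto
  moreover have "acyclic (Restr (arcs_ends G) X)" if "X \<in> P" for X
    using \<phi>(2) by (rule acyclic_subset) (use that in \<open>auto simp: P_def monochr_def\<close>)
  moreover have "card P \<le> card (\<phi> ` verts G)" unfolding P_def by (intro card_image_le) auto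
  moreover have "card (\<phi> ` verts G) \<le> card {..<m}" using \<phi>(1) by (intro card_mono) auto
  moreover have "finite P" by (simp add: P_def)
  ultimately show ?thesis by (auto simp: dicolouring_iff)
qed

text \<open>Positivity excludes a mismatch: the empty digraph has dichromatic number
  \<open>0\<close> but is not \<open>colourable 0\<close>.\<close>

lemma (in digraph) dichromatic_number_le_iff:
  assumes "0 < m"
  shows "dichromatic_number G \<le> m \<longleftrightarrow> colourable m (arcs_ends G)"
proof
  show "colourable m (arcs_ends G)" if "dichromatic_number G \<le> m"
    using dichromatic_number_attained colourable_if_dicolouring assms that by metis
next
  assume "colourable m (arcs_ends G)"
  then obtain P where "dicolouring G P" "finite P" "card P \<le> m"
    using ex_dicolouring_if_colourable by auto
  moreover from this have "dichromatic_number G \<le> card P"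
    unfolding dichromatic_number_def by (intro Least_le) auto
  ultimately show "dichromatic_number G \<le> m" by simp
qed

lemma (in digraph) card_arcs_ends: "card (arcs_ends G) = card (arcs G)"
  unfolding arcs_ends_def using no_multi_arcs by (intro card_image inj_onI)

text \<open>Deleting arcs gives proper subdigraphs, hence minimality. Deleting an isolated vertex
  would keep the arc relation and so remain uncolourable; hence no vertex is lost by passing to
  \<open>Field\<close>.\<close>

lemma (in digraph) dicritical_imp_critical:
  assumes crit: "dicritical k G" and k: "2 \<le> k"
  shows "critical (k - 1) (arcs_ends G)" "Field (arcs_ends G) = verts G"
proof -
  let ?m = "k - 1"
  have m: "0 < ?m" using k by simp
  have "\<not> dichromatic_number G \<le> ?m" using crit k by (simp add: dicritical_def)
  then have no: "\<not> colourable ?m (arcs_ends G)" using dichromatic_number_le_iff[OF m] by simp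
  have sub: "colourable ?m (arcs_ends H)" if H: "subgraph H G" "H \<noteq> G" for H
  proof -
    interpret H: digraph H using H(1) by (rule digraph_subgraph)
    have "dichromatic_number H \<le> ?m" using crit H by (simp add: dicritical_def)
    then show ?thesis using H.dichromatic_number_le_iff[OF m] by simp
  qed
  show "critical ?m (arcs_ends G)"
    unfolding critical_def
  proof (intro conjI allI impI)
    fix B assume B: "B \<subset> arcs_ends G"
    let ?H = "G\<lparr>arcs := {e \<in> arcs G. arc_to_ends G e \<in> B}\<rparr>"
    have ends: "arcs_ends ?H = B" using B by (auto simp: arcs_ends_def arc_to_ends_def image_iff)
    then have "?H \<noteq> G" using B by auto
    moreover have "subgraph ?H G"
      unfolding subgraph_def compatible_def
      by (intro conjI) (unfold_locales, auto)
    ultimately have "colourable ?m (arcs_ends ?H)" by (intro sub)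
    then show "colourable ?m B" by (simp only: ends)
  qed (rule no)
  show "Field (arcs_ends G) = verts G"
  proof (rule ccontr)
    assume "Field (arcs_ends G) \<noteq> verts G"
    then obtain v where v: "v \<in> verts G" "v \<notin> Field (arcs_ends G)"
      using arcs_ends_in_verts by (auto simp: Field_def)
    let ?H = "G\<lparr>verts := verts G - {v}\<rparr>"
    have "tail G e \<noteq> v \<and> head G e \<noteq> v" if "e \<in> arcs G" for e
      using that v(2)
        by (auto simp: Field_def arcs_ends_def arc_to_ends_def Domain_iff Range_iff image_iff)
    then have "subgraph ?H G"
      unfolding subgraph_def compatible_def
      by (intro conjI) (unfold_locales, auto)
    moreover have "verts ?H \<noteq> verts G" using v(1) by auto
    then have "?H \<noteq> G" by metis
    moreover have "arcs_ends ?H = arcs_ends G" by (simp add: arcs_ends_def arc_to_ends_def)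
    ultimately show False using sub no by metis
  qed
qed

lemma (in digraph) digraph_iso_with_projI:
  assumes inj: "inj_on f (verts G)" and V: "f ` verts G = pverts D"
    and A: "map_prod f f ` arcs_ends G = parcs D"
  shows "digraph_iso G (with_proj D)"
proof -
  define h where "h = \<lparr> iso_verts = f, iso_arcs = (\<lambda>e. (f (tail G e), f (head G e))),
    iso_head = snd, iso_tail = fst \<rparr>"
  have "inj_on (iso_arcs h) (arcs G)"
    by (rule inj_onI)
      (auto simp: h_def arc_to_ends_def inj_on_eq_iff[OF inj] intro!: no_multi_arcs)
  then have "digraph_isomorphism h"
    using inj wf_digraph by (auto simp: digraph_isomorphism_def h_def)
  moreover have "iso_arcs h ` arcs G = parcs D"
    unfolding A[symmetric] by (auto simp: h_def arcs_ends_conv image_image)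
  then have "with_proj D = app_iso h G"
    using V by (simp add: app_iso_def with_proj_def h_def)
  ultimately show ?thesis unfolding digraph_iso_def by blast
qed

section \<open>The exceptional relations as substitutions into the 5-cycle\<close>

lemma parcs_bidirected_cycle_5:
  "parcs (bidirected_cycle 5) =
    {(0, 1), (1, 0), (1, 2), (2, 1), (2, 3), (3, 2), (3, 4), (4, 3), (4, 0), (0, 4)}" (is "_ = ?C")
proof
  show "parcs (bidirected_cycle 5) \<subseteq> ?C"
  proof (rule subrelI)
    fix i j assume "(i, j) \<in> parcs (bidirected_cycle 5)"
    then have ij: "i < 5" "j < 5" "j = (i + 1) mod 5 \<or> i = (j + 1) mod 5"
      by (auto simp: bidirected_cycle_def)
    then have "i \<in> {0, 1, 2, 3, 4}" "j \<in> {0, 1, 2, 3, 4}" by auto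
    with ij(3) show "(i, j) \<in> ?C" by (elim insertE disjE) simp_all
  qed
qed (simp add: bidirected_cycle_def)

text \<open>All parts are complete, so on both sides distinct vertices are adjacent exactly when
  their parts are equal or consecutive on the cycle. Any bijection respecting the parts is therefore
  an isomorphism.\<close>

lemma dirac_digraph_substitution:
  assumes D: "dirac_digraph m A" and m: "2 \<le> m" and V: "V = Field A"
  obtains f E where "E \<in> \<D> (m + 1)" "inj_on f V" "f ` V = pverts E" "map_prod f f ` A = parcs E"
proof -
  from D[unfolded dirac_digraph_def] obtain S a b B C where D: "card S = m - 1" "card (B \<union> C) = m" "B \<noteq> {}" "C \<noteq> {}"
    "a \<noteq> b" "B \<inter> C = {}" "S \<inter> (B \<union> C) = {}" "{a, b} \<inter> (S \<union> B \<union> C) = {}"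
    "A = complete_on (insert a S) \<union> complete_on (insert b S) \<union> complete_on (B \<union> C) \<union>
       complete_on (insert a B) \<union> complete_on (insert b C)"
    by (elim exE conjE) (rule that)
  have fin: "finite S" "finite B" "finite C"
    using D(1,2) m card_ge_0_finite[of S] card_ge_0_finite[of "B \<union> C"] by auto
  have cBC: "card B + card C = m" using D(2,6) fin by (simp add: card_Un_disjoint)
  have c1: "1 \<le> card B" "1 \<le> card C" using D(3,4) fin by (auto simp: Suc_le_eq card_gt_0_iff)
  \<comment> \<open>For \<open>k = m + 1\<close> and \<open>n = card B\<close>, the sizes
    \<open>k - 2\<close> and \<open>k - 1 - n\<close> are \<open>m - 1\<close> and
    \<open>m - card B = card C\<close>.\<close>
  define N where "N = [bidirected_complete (m - 1), bidirected_complete 1, bidirected_complete (card B),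
    bidirected_complete (m - card B), bidirected_complete 1]"
  define E where "E = substitution (bidirected_cycle 5) (\<lambda>i. N ! i)"
  have ED: "E \<in> \<D> (m + 1)"
    unfolding \<D>_def E_def N_def using c1 cBC by (auto intro!: exI[of _ "card B"])
  obtain s where s: "bij_betw s S {0..<m - 1}" using ex_bij_betw_finite_nat[OF fin(1)] D(1) by auto
  obtain \<beta> where \<beta>: "bij_betw \<beta> B {0..<card B}" using ex_bij_betw_finite_nat[OF fin(2)] by auto
  obtain \<gamma> where \<gamma>: "bij_betw \<gamma> C {0..<m - card B}"
    using ex_bij_betw_finite_nat[OF fin(3)] cBC by (metis diff_add_inverse)
  \<comment> \<open>\<open>g\<close> is the index of the part containing \<open>v\<close>, and
    \<open>h\<close> below is the position of \<open>v\<close> within that part.\<close>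
  define g where "g v = (if v \<in> S then 0 else if v = a then 1 else if v \<in> B then 2
    else if v \<in> C then 3 else 4 :: nat)" for v
  define h where "h v = (if v \<in> S then s v else if v \<in> B then \<beta> v else if v \<in> C then \<gamma> v else 0)"
    for v
  define f where "f v = (g v, h v)" for v
  define W where "W = insert a (insert b (S \<union> B \<union> C))"
  have disj: "a \<notin> S" "a \<notin> B" "a \<notin> C" "b \<notin> S" "b \<notin> B" "b \<notin> C" using D(8) by auto
  have gS: "g v = 0" if "v \<in> S" for v using that by (simp add: g_def)
  have gB: "g v = 2" if "v \<in> B" for v using that D(7) disj by (auto simp: g_def)
  have gC: "g v = 3" if "v \<in> C" for v using that D(6,7) disj by (auto simp: g_def)
  have gab: "g a = 1" "g b = 4" using disj D(5) by (auto simp: g_def)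
  have hS: "h v = s v" if "v \<in> S" for v using that by (simp add: h_def)
  have hB: "h v = \<beta> v" if "v \<in> B" for v using that D(7) by (auto simp: h_def)
  have hC: "h v = \<gamma> v" if "v \<in> C" for v using that D(6,7) by (auto simp: h_def)
  have hab: "h a = 0" "h b = 0" using disj by (auto simp: h_def)
  have W_cases: "v \<in> S \<or> v = a \<or> v \<in> B \<or> v \<in> C \<or> v = b" if "v \<in> W"
    for v using that by (auto simp: W_def)
  have part: "g v = 0 \<Longrightarrow> v \<in> S" "g v = 1 \<Longrightarrow> v = a" "g v = 2 \<Longrightarrow> v \<in> B" "g v = 3 \<Longrightarrow> v \<in> C" "g v = 4 \<Longrightarrow> v = b"
    if "v \<in> W" for v
    using W_cases[OF that] gS[of v] gB[of v] gC[of v] gab by (elim disjE; simp)+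
  have img: "f ` S = {0} \<times> {..<m - 1}" "f ` B = {2} \<times> {..<card B}" "f ` C = {3} \<times> {..<m - card B}"
    "f a = (1, 0)" "f b = (4, 0)"
  proof -
    have "f ` S = Pair 0 ` s ` S" "f ` B = Pair 2 ` \<beta> ` B" "f ` C = Pair 3 ` \<gamma> ` C"
      unfolding image_image by (auto simp: f_def gS gB gC hS hB hC intro!: image_cong)
    then show "f ` S = {0} \<times> {..<m - 1}" "f ` B = {2} \<times> {..<card B}" "f ` C = {3} \<times> {..<m - card B}"
      using s \<beta> \<gamma> by (auto simp: bij_betw_def)
  qed (simp_all add: f_def gab hab)
  have injW: "inj_on f W"
  proof (rule inj_onI)
    fix u v assume uv: "u \<in> W" "v \<in> W" "f u = f v"
    then have eq: "g u = g v" "h u = h v" by (simp_all add: f_def)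
    note part = part[OF uv(2), folded eq]
    from W_cases[OF uv(1)] show "u = v"
    proof (elim disjE)
      assume u: "u \<in> S"
      then have "v \<in> S" using part gS by simp
      then show ?thesis
        using inj_onD[OF bij_betw_imp_inj_on[OF s], of u v] u eq(2) by (simp add: hS)
    next
      assume u: "u \<in> B"
      then have "v \<in> B" using part gB by simp
      then show ?thesis
        using inj_onD[OF bij_betw_imp_inj_on[OF \<beta>], of u v] u eq(2) by (simp add: hB)
    next
      assume u: "u \<in> C"
      then have "v \<in> C" using part gC by simp
      then show ?thesis
        using inj_onD[OF bij_betw_imp_inj_on[OF \<gamma>], of u v] u eq(2) by (simp add: hC)
    qed (use part gab in simp_all)
  qed
  have pE: "pverts E = {0} \<times> {..<m - 1} \<union> {1} \<times> {..<1} \<union> {2} \<times> {..<card B} \<union> {3} \<times> {..<m - card B} \<union> {4} \<times> {..<1}"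
  proof -
    have five: "{..<5} = {0, 1, 2, 3, 4 :: nat}" by auto
    have Sig: "Sigma {0, 1, 2, 3, 4} F = {0} \<times> F 0 \<union> {1} \<times> F 1 \<union> {2} \<times> F 2 \<union> {3} \<times> F 3 \<union> {4} \<times> F 4"
      for F :: "nat \<Rightarrow> nat set"
      by auto
    have "pverts E = (SIGMA i:{..<5}. pverts (N ! i))"
      by (simp add: E_def substitution_def bidirected_cycle_def)
    then show ?thesis
      unfolding five Sig by (simp add: N_def bidirected_complete_def)
  qed
  have fW: "f ` W = pverts E"
    unfolding pE W_def image_insert image_Un img by auto
  have aE: "parcs E = {(p, q) \<in> pverts E \<times> pverts E. p \<noteq> q \<and>
      (fst p = fst q \<or> (fst p, fst q) \<in> parcs (bidirected_cycle 5))}"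
  proof -
    have N: "parcs (N ! i) = {(x, y) \<in> pverts (N ! i) \<times> pverts (N ! i). x \<noteq> y}" if "i < 5" for i
    proof -
      have "i \<in> {0, 1, 2, 3, 4}" using that by auto
      then show ?thesis by (elim insertE) (simp_all add: N_def bidirected_complete_def)
    qed
    have irr: "(i, i) \<notin> parcs (bidirected_cycle 5)" for i
      by (auto simp: bidirected_cycle_def mod_Suc)
    have vert: "i < 5 \<and> j < 5" if "(i, j) \<in> parcs (bidirected_cycle 5)" for i j
      using that by (auto simp: bidirected_cycle_def)
    have pv: "pverts (bidirected_cycle 5) = {..<5}" by (simp add: bidirected_cycle_def)
    show ?thesis
      unfolding E_def substitution_def using N irr by (auto simp: pv dest: vert)
  qed
  have A: "A = {(u, v) \<in> W \<times> W. u \<noteq> v \<and> (g u = g v \<or> (g u, g v) \<in> parcs (bidirected_cycle 5))}"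
    (is "_ = ?R")
  proof
    have sub: "complete_on X \<subseteq> ?R"
      if "X \<subseteq> W" "\<And>u v. u \<in> X \<Longrightarrow> v \<in> X \<Longrightarrow> g u = g v \<or> (g u, g v) \<in> parcs (bidirected_cycle 5)" for X
      using that by (auto simp: complete_on_def)
    show "A \<subseteq> ?R"
      unfolding D(9)
    proof (intro Un_least sub)
      fix u v
      show "g u = g v \<or> (g u, g v) \<in> parcs (bidirected_cycle 5)"
        if "u \<in> insert a S" "v \<in> insert a S"
        using that gS gab by (elim insertE) (simp_all add: parcs_bidirected_cycle_5)
      show "g u = g v \<or> (g u, g v) \<in> parcs (bidirected_cycle 5)"
        if "u \<in> insert b S" "v \<in> insert b S"
        using that gS gab by (elim insertE) (simp_all add: parcs_bidirected_cycle_5)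
      show "g u = g v \<or> (g u, g v) \<in> parcs (bidirected_cycle 5)" if "u \<in> B \<union> C" "v \<in> B \<union> C"
        using that gB gC by (elim UnE) (simp_all add: parcs_bidirected_cycle_5)
      show "g u = g v \<or> (g u, g v) \<in> parcs (bidirected_cycle 5)"
        if "u \<in> insert a B" "v \<in> insert a B"
        using that gB gab by (elim insertE) (simp_all add: parcs_bidirected_cycle_5)
      show "g u = g v \<or> (g u, g v) \<in> parcs (bidirected_cycle 5)"
        if "u \<in> insert b C" "v \<in> insert b C"
        using that gC gab by (elim insertE) (simp_all add: parcs_bidirected_cycle_5)
    qed (auto simp: W_def)
    show "?R \<subseteq> A"
    proof (rule subrelI)
      fix u v assume "(u, v) \<in> ?R"
      then have uv: "u \<in> W" "v \<in> W" "u \<noteq> v" "g u = g v \<or> (g u, g v) \<in> parcs (bidirected_cycle 5)"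
        by auto
      from W_cases[OF uv(1)] show "(u, v) \<in> A"
      proof (elim disjE)
        assume u: "u \<in> S"
        have "g v = 0 \<or> g v = 1 \<or> g v = 4"
          using uv(4) gS[OF u] by (auto simp add: parcs_bidirected_cycle_5)
        then have "v \<in> S \<or> v = a \<or> v = b" using part[OF uv(2)] by metis
        with u uv(3) show ?thesis unfolding D(9) complete_on_def by blast
      next
        assume u: "u = a"
        have "g v = 0 \<or> g v = 1 \<or> g v = 2"
          using uv(4) u gab(1) by (auto simp add: parcs_bidirected_cycle_5)
        then have "v \<in> S \<or> v = a \<or> v \<in> B" using part[OF uv(2)] by metis
        with u uv(3) show ?thesis unfolding D(9) complete_on_def by blast
      next
        assume u: "u \<in> B"
        have "g v = 2 \<or> g v = 1 \<or> g v = 3"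
          using uv(4) gB[OF u] by (auto simp add: parcs_bidirected_cycle_5)
        then have "v \<in> B \<or> v = a \<or> v \<in> C" using part[OF uv(2)] by metis
        with u uv(3) show ?thesis unfolding D(9) complete_on_def by blast
      next
        assume u: "u \<in> C"
        have "g v = 3 \<or> g v = 4 \<or> g v = 2"
          using uv(4) gC[OF u] by (auto simp add: parcs_bidirected_cycle_5)
        then have "v \<in> C \<or> v = b \<or> v \<in> B" using part[OF uv(2)] by metis
        with u uv(3) show ?thesis unfolding D(9) complete_on_def by blast
      next
        assume u: "u = b"
        have "g v = 0 \<or> g v = 4 \<or> g v = 3"
          using uv(4) u gab(2) by (auto simp add: parcs_bidirected_cycle_5)
        then have "v \<in> S \<or> v = b \<or> v \<in> C" using part[OF uv(2)] by metis
        with u uv(3) show ?thesis unfolding D(9) complete_on_def by blast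
      qed
    qed
  qed
  have "Field A = W"
  proof
    show "Field A \<subseteq> W" by (subst A) (auto simp: Field_def)
    have arcs: "\<And>v. v \<in> S \<Longrightarrow> (v, a) \<in> A" "\<And>v. v \<in> B \<Longrightarrow> (v, a) \<in> A" "\<And>v. v \<in> C \<Longrightarrow> (v, b) \<in> A"
      using disj by (auto simp: D(9) complete_on_def)
    show "W \<subseteq> Field A"
    proof
      fix v assume "v \<in> W"
      from W_cases[OF this] show "v \<in> Field A"
        using arcs D(3,4) by (auto intro: FieldI1 FieldI2)
    qed
  qed
  moreover have "map_prod f f ` A = parcs E"
    unfolding aE fW[symmetric]
  proof
    show "map_prod f f ` A \<subseteq> {(p, q) \<in> f ` W \<times> f ` W. p \<noteq> q \<and>
      (fst p = fst q \<or> (fst p, fst q) \<in> parcs (bidirected_cycle 5))}"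
    proof (rule subrelI)
      fix p q assume "(p, q) \<in> map_prod f f ` A"
      then obtain u v where uv: "(u, v) \<in> A" "p = f u" "q = f v" by auto
      then have "u \<in> W" "v \<in> W" "u \<noteq> v" and adj: "g u = g v \<or> (g u, g v) \<in> parcs (bidirected_cycle 5)"
        using A by auto
      then have "f u \<noteq> f v" using inj_onD[OF injW] by auto
      moreover have "fst (f u) = fst (f v) \<or> (fst (f u), fst (f v)) \<in> parcs (bidirected_cycle 5)"
        using adj by (simp add: f_def)
      ultimately show "(p, q) \<in> {(p, q) \<in> f ` W \<times> f ` W. p \<noteq> q \<and>
        (fst p = fst q \<or> (fst p, fst q) \<in> parcs (bidirected_cycle 5))}"
        using uv(2,3) \<open>u \<in> W\<close> \<open>v \<in> W\<close> by simp
    qed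
    show "{(p, q) \<in> f ` W \<times> f ` W. p \<noteq> q \<and>
      (fst p = fst q \<or> (fst p, fst q) \<in> parcs (bidirected_cycle 5))} \<subseteq> map_prod f f ` A"
    proof (rule subrelI)
      fix p q assume "(p, q) \<in> {(p, q) \<in> f ` W \<times> f ` W. p \<noteq> q \<and>
        (fst p = fst q \<or> (fst p, fst q) \<in> parcs (bidirected_cycle 5))}"
      then obtain u v where uv: "u \<in> W" "v \<in> W" "p = f u" "q = f v" "p \<noteq> q"
        "fst p = fst q \<or> (fst p, fst q) \<in> parcs (bidirected_cycle 5)" by auto
      then have "(u, v) \<in> A" by (subst A) (auto simp: f_def)
      then have "map_prod f f (u, v) \<in> map_prod f f ` A" by (rule imageI)
      then show "(p, q) \<in> map_prod f f ` A" using uv(3,4) by simp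
    qed
  qed
  ultimately show ?thesis using that[OF ED] injW fW V by simp
qed

theorem theorem1p6:
  fixes G :: "('a, 'b) pre_digraph" and k :: nat
  assumes "k \<ge> 4"
    and "digraph G"
    and "dicritical k G"
    and "\<not> complete_digraph k G"
    and "\<not> (\<exists>D \<in> \<D> k. digraph_iso G (with_proj D))"
  shows "card (arcs G) \<ge> (k - 1) * card (verts G) + (k - 2)"
proof -
  interpret digraph G by (rule assms(2))
  let ?A = "arcs_ends G"
  have k: "2 \<le> k" "3 \<le> k - 1" "k - 1 + 1 = k" using assms(1) by auto
  note crit = dicritical_imp_critical[OF assms(3) k(1)]
  have "finite ?A" by (simp add: arcs_ends_def)
  moreover have "(v, v) \<notin> ?A" for v using no_loops by (auto simp: arcs_ends_def arc_to_ends_def)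
  moreover have "\<not> (?A = complete_on (Field ?A) \<and> card (Field ?A) = k - 1 + 1)"
  proof
    assume *: "?A = complete_on (Field ?A) \<and> card (Field ?A) = k - 1 + 1"
    then have A: "?A = {(u, v). (u, v) \<in> verts G \<times> verts G \<and> u \<noteq> v}"
      unfolding crit(2) by (auto simp: complete_on_def)
    then have "graph G" by (intro graphI) (auto simp: symmetric_def sym_def)
    then have "complete_digraph k G" using * A k crit(2) by (simp add: complete_digraph_def)
    then show False using assms(4) by simp
  qed
  moreover have "\<not> dirac_digraph (k - 1) ?A"
  proof
    assume D: "dirac_digraph (k - 1) ?A"
    have "2 \<le> k - 1" using k by simp
    obtain f E where E: "E \<in> \<D> (k - 1 + 1)" "inj_on f (verts G)" "f ` verts G = pverts E"
      "map_prod f f ` ?A = parcs E"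
      using dirac_digraph_substitution[OF D \<open>2 \<le> k - 1\<close> crit(2)[symmetric]] .
    from digraph_iso_with_projI[OF E(2-4)] show False using assms(5) E(1) k(3) by auto
  qed
  ultimately have "(k - 1) * card (Field ?A) + (k - 1) - 1 \<le> card ?A"
    using sparse_critical_cases[OF _ _ crit(1) k(2)] by blast
  \<comment> \<open>With \<open>m = k - 1\<close>, the final \<open>m - 1\<close> of the bound is
    \<open>k - 2\<close>.\<close>
  then show ?thesis using assms(1) by (simp add: crit(2) card_arcs_ends)
qed

end
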